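(* Let $R$ be a unital ring and $E$ a finite directed graph which is not the null graph. Let $S=M(\mathbb{Z},I)\cup\{0\}$ and $w$ a canonical weight mapping on $E$. Then $L_R(E)$, with the canonical $S$-grading determined by $w$, is graded von Neumann regular if and only if $R$ is von Neumann regular.
   Context: Directed graph $E=(E^0,E^1,\mathrm{r},\mathrm{s})$; finite means $E^0$ finite; not null means $E^0\neq\emptyset$; paths $E^*$ (vertices as length-$0$ paths); $\mathrm{Reg}(E)$ = vertices $v$ with $\mathrm{s}^{-1}(v)$ nonempty finite. $L_R(E)$ is the $R$-algebra generated by $E^0$, $E^1$, $\{\alpha^*\}$ ($R$ commuting with generators) with relations $vv'=\delta_{v,v'}v$; $\mathrm{s}(\alpha)\alpha=\alpha\mathrm{r}(\alpha)=\alpha$, $\mathrm{r}(\alpha)\alpha^*=\alpha^*\mathrm{s}(\alpha)=\alpha^*$; $\alpha^*\alpha'=\delta_{\alpha,\alpha'}\mathrm{r}(\alpha)$; $\sum_{\mathrm{s}(\alpha)=v}\alpha\alpha^*=v$ for $v\in\mathrm{Reg}(E)$. $M(\mathbb{Z},I)=I\times\mathbb{Z}\times I$, $(i,a,j)(k,b,l)=(i,a+b,l)$ if $j=k$, else undefined; $S=M(\mathbb{Z},I)\cup\{0\}$, undefined products $0$, $0$ absorbing; $(i,a,j)^{-1}=(j,-a,i)$. Canonical weight mapping: vertices get weights $(i,0,i)$, edges $(i,1,j)$, $w(\alpha^* )=w(\alpha)^{-1}$, $w(\mathrm{s}(\alpha))w(\alpha)=w(\alpha)=w(\alpha)w(\mathrm{r}(\alpha))$;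 for each nonzero idempotent $f$, edges with source of weight $f$ share a weight and edges with range of weight $f$ share a weight; extended multiplicatively with $w(\mu\eta^* )=w(\mu)w(\eta)^{-1}$. Canonical grading: $(L_R(E))_s$ = $R$-span of $\mu\eta^*$, $\mathrm{r}(\mu)=\mathrm{r}(\eta)$, $w(\mu\eta^* )=s$; $(L_R(E))_0=0$. A graded ring $A=\bigoplus_sA_s$ is graded von Neumann regular if $x\in xAx$ for every $x\in\bigcup_sA_s$. *)

theory Defs
  imports Main "HOL-Library.Function_Algebras"
begin

text \<open>None plays the role of the zero element 0 of S; Some (i,a,j) is (i,a,j).\<close>
type_synonym 'i semi = "('i \<times> int \<times> 'i) option"

fun smul :: "'i semi \<Rightarrow> 'i semi \<Rightarrow> 'i semi" where
  "smul (Some (i,a,j)) (Some (k,b,l)) = (if j = k then Some (i, a+b, l) else None)"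
| "smul _ _ = None"

fun sinv :: "'i semi \<Rightarrow> 'i semi" where
  "sinv (Some (i,a,j)) = Some (j, -a, i)"
| "sinv None = None"

datatype ('v,'e) gen = Vx 'v | Ed 'e | Gh 'e

definition gens :: "'v set \<Rightarrow> 'e set \<Rightarrow> ('v,'e) gen set" where
  "gens V E1 = Vx ` V \<union> Ed ` E1 \<union> Gh ` E1"

text \<open>Elements are finitely supported coefficient functions on nonempty words of
generators; coefficients from R commute with the generators.\<close>

definition FA :: "'v set \<Rightarrow> 'e set \<Rightarrow> (('v,'e) gen list \<Rightarrow> 'r::{ring,monoid_mult}) set" where
  "FA V E1 = {p. finite {u. p u \<noteq> 0} \<and>
      (\<forall>u. p u \<noteq> 0 \<longrightarrow> u \<noteq> [] \<and> set u \<subseteq> gens V E1)}"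

definition fa_mult :: "('g list \<Rightarrow> 'r::{ring,monoid_mult}) \<Rightarrow> ('g list \<Rightarrow> 'r) \<Rightarrow> 'g list \<Rightarrow> 'r" where
  "fa_mult p q u = (\<Sum>k\<le>length u. p (take k u) * q (drop k u))"

definition fa_smult :: "'r::{ring,monoid_mult} \<Rightarrow> ('g list \<Rightarrow> 'r) \<Rightarrow> 'g list \<Rightarrow> 'r" where
  "fa_smult c p = (\<lambda>u. c * p u)"

definition fa_mono :: "'g list \<Rightarrow> 'g list \<Rightarrow> 'r::{ring,monoid_mult}" where
  "fa_mono w = (\<lambda>u. if u = w then 1 else 0)"

definition Reg :: "'v set \<Rightarrow> 'e set \<Rightarrow> ('e \<Rightarrow> 'v) \<Rightarrow> 'v set" where
  "Reg V E1 s = {v \<in> V. {a \<in> E1. s a = v} \<noteq> {} \<and> finite {a \<in> E1. s a = v}}"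

definition lpa_rels :: "'v set \<Rightarrow> 'e set \<Rightarrow> ('e \<Rightarrow> 'v) \<Rightarrow> ('e \<Rightarrow> 'v)
    \<Rightarrow> (('v,'e) gen list \<Rightarrow> 'r::{ring,monoid_mult}) set" where
  "lpa_rels V E1 s r =
     {fa_mono [Vx v, Vx v'] - (if v = v' then fa_mono [Vx v] else 0) | v v'. v \<in> V \<and> v' \<in> V}
   \<union> {fa_mono [Vx (s a), Ed a] - fa_mono [Ed a] | a. a \<in> E1}
   \<union> {fa_mono [Ed a, Vx (r a)] - fa_mono [Ed a] | a. a \<in> E1}
   \<union> {fa_mono [Vx (r a), Gh a] - fa_mono [Gh a] | a. a \<in> E1}
   \<union> {fa_mono [Gh a, Vx (s a)] - fa_mono [Gh a] | a. a \<in> E1}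
   \<union> {fa_mono [Gh a, Ed a'] - (if a = a' then fa_mono [Vx (r a)] else 0) | a a'. a \<in> E1 \<and> a' \<in> E1}
   \<union> {(\<Sum>a\<in>{a \<in> E1. s a = v}. fa_mono [Ed a, Gh a]) - fa_mono [Vx v] | v. v \<in> Reg V E1 s}"

inductive_set lpa_ideal :: "'v set \<Rightarrow> 'e set \<Rightarrow> ('e \<Rightarrow> 'v) \<Rightarrow> ('e \<Rightarrow> 'v)
    \<Rightarrow> (('v,'e) gen list \<Rightarrow> 'r::{ring,monoid_mult}) set"
  for V E1 s r where
  rel: "x \<in> lpa_rels V E1 s r \<Longrightarrow> x \<in> lpa_ideal V E1 s r"
| zero: "0 \<in> lpa_ideal V E1 s r"
| add: "x \<in> lpa_ideal V E1 s r \<Longrightarrow> y \<in> lpa_ideal V E1 s r \<Longrightarrow> x + y \<in> lpa_ideal V E1 s r"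
| smult: "x \<in> lpa_ideal V E1 s r \<Longrightarrow> fa_smult c x \<in> lpa_ideal V E1 s r"
| lmult: "x \<in> lpa_ideal V E1 s r \<Longrightarrow> p \<in> FA V E1 \<Longrightarrow> fa_mult p x \<in> lpa_ideal V E1 s r"
| rmult: "x \<in> lpa_ideal V E1 s r \<Longrightarrow> p \<in> FA V E1 \<Longrightarrow> fa_mult x p \<in> lpa_ideal V E1 s r"

text \<open>L_R(E) = FA V E1 modulo lpa_ideal; elements of L_R(E) are represented by
elements of FA, and x = y in L_R(E) iff x - y \<in> lpa_ideal.\<close>

text \<open>A path is (v, es): the vertex v if es = [], otherwise the edge list es starting at v.\<close>
definition is_path :: "'v set \<Rightarrow> 'e set \<Rightarrow> ('e \<Rightarrow> 'v) \<Rightarrow> ('e \<Rightarrow> 'v) \<Rightarrow> 'v \<times> 'e list \<Rightarrow> bool" where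
  "is_path V E1 s r p = (case p of (v, es) \<Rightarrow>
      v \<in> V \<and> set es \<subseteq> E1 \<and> (es \<noteq> [] \<longrightarrow> s (hd es) = v) \<and>
      (\<forall>i. Suc i < length es \<longrightarrow> r (es ! i) = s (es ! Suc i)))"

definition path_r :: "('e \<Rightarrow> 'v) \<Rightarrow> 'v \<times> 'e list \<Rightarrow> 'v" where
  "path_r r p = (case p of (v, es) \<Rightarrow> if es = [] then v else r (last es))"

definition path_word :: "'v \<times> 'e list \<Rightarrow> ('v,'e) gen list" where
  "path_word p = (case p of (v, es) \<Rightarrow> if es = [] then [Vx v] else map Ed es)"

definition ghost_word :: "'v \<times> 'e list \<Rightarrow> ('v,'e) gen list" where
  "ghost_word p = (case p of (v, es) \<Rightarrow> if es = [] then [Vx v] else rev (map Gh es))"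

definition canonical_weight :: "'v set \<Rightarrow> 'e set \<Rightarrow> ('e \<Rightarrow> 'v) \<Rightarrow> ('e \<Rightarrow> 'v)
    \<Rightarrow> (('v,'e) gen \<Rightarrow> 'i semi) \<Rightarrow> bool" where
  "canonical_weight V E1 s r w \<longleftrightarrow>
     (\<forall>v\<in>V. \<exists>i. w (Vx v) = Some (i, 0, i)) \<and>
     (\<forall>a\<in>E1. \<exists>i j. w (Ed a) = Some (i, 1, j)) \<and>
     (\<forall>a\<in>E1. w (Gh a) = sinv (w (Ed a))) \<and>
     (\<forall>a\<in>E1. smul (w (Vx (s a))) (w (Ed a)) = w (Ed a) \<and>
              smul (w (Ed a)) (w (Vx (r a))) = w (Ed a)) \<and>
     (\<forall>f. f \<noteq> None \<and> smul f f = f \<longrightarrow>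
        (\<forall>a\<in>E1. \<forall>b\<in>E1. w (Vx (s a)) = f \<and> w (Vx (s b)) = f \<longrightarrow> w (Ed a) = w (Ed b)) \<and>
        (\<forall>a\<in>E1. \<forall>b\<in>E1. w (Vx (r a)) = f \<and> w (Vx (r b)) = f \<longrightarrow> w (Ed a) = w (Ed b)))"

definition path_weight :: "(('v,'e) gen \<Rightarrow> 'i semi) \<Rightarrow> 'v \<times> 'e list \<Rightarrow> 'i semi" where
  "path_weight w p = (case p of (v, es) \<Rightarrow>
      if es = [] then w (Vx v)
      else foldl smul (w (Ed (hd es))) (map (\<lambda>e. w (Ed e)) (tl es)))"

definition mon_weight :: "(('v,'e) gen \<Rightarrow> 'i semi) \<Rightarrow> 'v \<times> 'e list \<Rightarrow> 'v \<times> 'e list \<Rightarrow> 'i semi" where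
  "mon_weight w \<mu> \<eta> = smul (path_weight w \<mu>) (sinv (path_weight w \<eta>))"

inductive_set weight_span :: "'v set \<Rightarrow> 'e set \<Rightarrow> ('e \<Rightarrow> 'v) \<Rightarrow> ('e \<Rightarrow> 'v)
    \<Rightarrow> (('v,'e) gen \<Rightarrow> 'i semi) \<Rightarrow> 'i semi \<Rightarrow> (('v,'e) gen list \<Rightarrow> 'r::{ring,monoid_mult}) set"
  for V E1 s r w g where
  zero: "0 \<in> weight_span V E1 s r w g"
| step: "y \<in> weight_span V E1 s r w g \<Longrightarrow> is_path V E1 s r \<mu> \<Longrightarrow> is_path V E1 s r \<eta> \<Longrightarrow>
         path_r r \<mu> = path_r r \<eta> \<Longrightarrow> mon_weight w \<mu> \<eta> = g \<Longrightarrow>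
         y + fa_smult c (fa_mono (path_word \<mu> @ ghost_word \<eta>)) \<in> weight_span V E1 s r w g"

text \<open>Homogeneous component (L_R(E))_g of the canonical grading, as the set of
representatives in the free algebra; (L_R(E))_0 = 0.\<close>
definition lpa_comp :: "'v set \<Rightarrow> 'e set \<Rightarrow> ('e \<Rightarrow> 'v) \<Rightarrow> ('e \<Rightarrow> 'v)
    \<Rightarrow> (('v,'e) gen \<Rightarrow> 'i semi) \<Rightarrow> 'i semi \<Rightarrow> (('v,'e) gen list \<Rightarrow> 'r::{ring,monoid_mult}) set" where
  "lpa_comp V E1 s r w g = {x \<in> FA V E1.
      if g = None then x \<in> lpa_ideal V E1 s r
      else (\<exists>y \<in> weight_span V E1 s r w g. x - y \<in> lpa_ideal V E1 s r)}"

definition lpa_graded_vnr :: "'v set \<Rightarrow> 'e set \<Rightarrow> ('e \<Rightarrow> 'v) \<Rightarrow> ('e \<Rightarrow> 'v)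
    \<Rightarrow> (('v,'e) gen \<Rightarrow> 'i semi) \<Rightarrow> 'r::{ring,monoid_mult} itself \<Rightarrow> bool" where
  "lpa_graded_vnr V E1 s r w _ \<longleftrightarrow>
     (\<forall>g. \<forall>x \<in> (lpa_comp V E1 s r w g :: (('v,'e) gen list \<Rightarrow> 'r) set).
        \<exists>y \<in> FA V E1. x - fa_mult (fa_mult x y) x \<in> lpa_ideal V E1 s r)"

definition von_neumann_regular :: "'r::{ring,monoid_mult} itself \<Rightarrow> bool" where
  "von_neumann_regular _ \<longleftrightarrow> (\<forall>a::'r. \<exists>b. a = a * b * a)"

end

theory Submission
  imports Defs
begin

text \<open>If \<open>a v = a v y a v\<close> in the Leavitt path algebra for a vertex \<open>v\<close> and a scalar \<open>a\<close>, let both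
  sides act on the free module over the boundary paths (infinite paths and paths ending in a
  non-regular vertex). The diagonal coefficient at a boundary path starting at \<open>v\<close> yields
  \<open>a = a b a\<close>, where \<open>b\<close> is the corresponding coefficient of \<open>y\<close>.

  Conversely, a homogeneous element involves a finite set \<open>F\<close> of edges, and the monomials
  \<open>\<mu> \<eta>\<^sup>*\<close> occurring in it have a common degree \<open>|\<mu>| - |\<eta>|\<close>. Put
  \<open>f\<^sub>v = v - \<Sum> a a\<^sup>*\<close>, the sum over the edges \<open>a\<close> in \<open>F\<close> with source \<open>v\<close>.
  Expanding \<open>\<mu> \<eta>\<^sup>* = \<mu> f\<^sub>v \<eta>\<^sup>* + \<Sum> \<mu> a a\<^sup>* \<eta>\<^sup>*\<close> up to a common length writes the element as
  \<open>\<Sum> c\<^sub>p\<^sub>q b\<^sub>p b\<^sub>q\<^sup>*\<close> with orthogonal families \<open>b\<close>, so that an inner inverse of the finite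
  matrix \<open>c\<close> over the regular ring of scalars gives an inner inverse of the element.\<close>

section \<open>Matrices over a von Neumann regular ring\<close>

text \<open>The sum is a right unit \<open>e\<close> for the left ideal generated by the entries
  \<open>c p\<close>. A further entry \<open>c x\<close> has the defect
  \<open>z = c x - c x * e\<close>; if \<open>b\<close> is an inner inverse of \<open>z\<close>,
  then \<open>e + (1 - e) * b * z\<close> is a right unit for the enlarged ideal.\<close>

lemma vnr_column:
  fixes c :: "'p \<Rightarrow> 'r::{ring,monoid_mult}"
  assumes "von_neumann_regular TYPE('r)" and "finite P"
  shows "\<exists>d. \<forall>p\<in>P. c p * (\<Sum>p'\<in>P. d p' * c p') = c p"
  using \<open>finite P\<close>
proof induction
  case empty
  then show ?case by simp
next
  case (insert x P)
  then obtain d where d: "\<And>p. p \<in> P \<Longrightarrow> c p * (\<Sum>p'\<in>P. d p' * c p') = c p" by blast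
  define e where "e = (\<Sum>p'\<in>P. d p' * c p')"
  define z where "z = c x - c x * e"
  obtain b where b: "z = z * b * z"
    using assms(1) unfolding von_neumann_regular_def by blast
  \<comment> \<open>\<open>t\<close> is \<open>(1 - e) * b\<close>, so every old \<open>c p\<close>
    annihilates it from the left. The correction of the old coefficients in \<open>d'\<close> turns
    \<open>t * c x\<close> into \<open>t * z\<close> in the new sum.\<close>
  define t where "t = (b - e * b)"
  define d' where "d' = (\<lambda>p. if p = x then t else (d p - t * c x * d p))"
  have "(\<Sum>p'\<in>insert x P. d' p' * c p') = t * c x + (\<Sum>p'\<in>P. d' p' * c p')"
    using insert by (simp add: d'_def)
  also have "(\<Sum>p'\<in>P. d' p' * c p') = (\<Sum>p'\<in>P. d p' * c p' - t * c x * (d p' * c p'))"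
    using insert(2) by (intro sum.cong) (auto simp: d'_def algebra_simps)
  also have "\<dots> = e - t * c x * e"
    unfolding e_def sum_subtractf sum_distrib_left by simp
  finally have sum: "(\<Sum>p'\<in>insert x P. d' p' * c p') = e + t * z"
    by (simp add: z_def algebra_simps)
  have "c p * (e + t * z) = c p" if "p \<in> P" for p
  proof -
    have "c p * e = c p" using d[OF that] by (simp add: e_def)
    then show ?thesis
      by (simp add: t_def algebra_simps) (simp add: mult.assoc[symmetric])
  qed
  moreover have "c x * (e + t * z) = c x"
  proof -
    have "c x * (e + t * z) = c x * e + z * b * z"
      by (simp add: t_def z_def algebra_simps)
    then show ?thesis by (simp add: b[symmetric]) (simp add: z_def)
  qed
  ultimately show ?case
    by (intro exI[of _ d']) (simp only: sum, auto)
qed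

text \<open>Only the summation index is confined to a set. Row and column indices range over whole
  types, so matrix identities become equations between functions.\<close>

definition matmul :: "'q set \<Rightarrow> ('p \<Rightarrow> 'q \<Rightarrow> 'r::{ring,monoid_mult}) \<Rightarrow> ('q \<Rightarrow> 't \<Rightarrow> 'r) \<Rightarrow> 'p \<Rightarrow> 't \<Rightarrow> 'r" where
  "matmul Q c d = (\<lambda>p t. \<Sum>q\<in>Q. c p q * d q t)"

lemma matmul_assoc: "matmul P (matmul Q a b) c = matmul Q a (matmul P b c)"
  unfolding matmul_def sum_distrib_left sum_distrib_right
  by (intro ext, subst sum.swap) (simp add: mult.assoc)

lemma matmul_add_left: "matmul Q (a + b) c = matmul Q a c + matmul Q b c"
  by (auto simp: matmul_def fun_eq_iff algebra_simps sum.distrib)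

lemma matmul_add_right: "matmul Q a (b + c) = matmul Q a b + matmul Q a c"
  by (auto simp: matmul_def fun_eq_iff algebra_simps sum.distrib)

lemma matmul_diff_left: "matmul Q (a - b) c = matmul Q a c - matmul Q b c"
  by (auto simp: matmul_def fun_eq_iff algebra_simps sum_subtractf)

lemma matmul_diff_right: "matmul Q a (b - c) = matmul Q a b - matmul Q a c"
  by (auto simp: matmul_def fun_eq_iff algebra_simps sum_subtractf)

lemmas matmul_simps = matmul_assoc matmul_add_left matmul_add_right matmul_diff_left matmul_diff_right

text \<open>Induction on the number of columns. An inner inverse for the columns in \<open>Q\<close> leaves a
  defect supported in the new column, and McCoy's lemma (a matrix \<open>c\<close> is regular as soon as
  \<open>c - c d c\<close> is) absorbs it.\<close>

lemma vnr_matrix: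
  fixes c :: "'p \<Rightarrow> 'q \<Rightarrow> 'r::{ring,monoid_mult}"
  assumes "von_neumann_regular TYPE('r)" and "finite P" and "finite Q"
  shows "\<exists>d. \<forall>p\<in>P. \<forall>q\<in>Q. matmul P (matmul Q c d) c p q = c p q"
  using \<open>finite Q\<close>
proof induction
  case empty
  then show ?case by simp
next
  case (insert x Q)
  then obtain d0 where d0: "\<And>p q. p \<in> P \<Longrightarrow> q \<in> Q \<Longrightarrow> matmul P (matmul Q c d0) c p q = c p q"
    by blast
  let ?m = "matmul P" and ?n = "matmul (insert x Q)"
  \<comment> \<open>A zero row at \<open>x\<close> makes the product over the enlarged index set
    agree with the product over \<open>Q\<close>.\<close>
  define d where "d = (\<lambda>q p. if q = x then 0 else d0 q p)"
  have cd: "?n c d = matmul Q c d0"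
    using insert(1,2) by (auto simp: matmul_def d_def fun_eq_iff intro!: sum.cong)
  define z where "z = c - ?m (?n c d) c"
  have z0: "z p q = 0" if "p \<in> P" "q \<in> Q" for p q
    using d0[OF that] by (simp add: z_def cd)
  obtain k where k: "\<And>p. p \<in> P \<Longrightarrow> z p x * (\<Sum>p'\<in>P. k p' * z p' x) = z p x"
    using vnr_column[OF assms(1,2), of "\<lambda>p. z p x"] by blast
  \<comment> \<open>Only row \<open>x\<close> of \<open>y\<close> is nonzero, so
    \<open>z y z\<close> sees just column \<open>x\<close> of the middle factor \<open>z\<close>,
    the only column where the defect can be nonzero.\<close>
  define y where "y = (\<lambda>q p. if q = x then k p else 0)"
  have zy: "?n z y p p' = z p x * k p'" for p p'
    using insert(1,2) by (auto simp: matmul_def y_def if_distrib sum.neutral)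
  have zyz: "?m (?n z y) z p q = z p q" if "p \<in> P" "q \<in> insert x Q" for p q
  proof -
    have "?m (?n z y) z p q = z p x * (\<Sum>p'\<in>P. k p' * z p' q)"
      by (simp add: matmul_def[of P] zy sum_distrib_left mult.assoc)
    also have "\<dots> = z p q"
      using that k z0 by (cases "q = x") auto
    finally show ?thesis .
  qed
  \<comment> \<open>This is \<open>d + (1 - d c) y (1 - c d)\<close> multiplied out, whence
    \<open>c D c = c d c + z y z\<close>.\<close>
  define D where "D = d + y - ?n (?m d c) y - ?m y (?n c d) + ?n (?m d c) (?m y (?n c d))"
  have "?m (?n c D) c = ?m (?n c d) c + ?m (?n z y) z"
    unfolding D_def z_def by (simp add: matmul_simps algebra_simps)
  then have "?m (?n c D) c p q = c p q" if "p \<in> P" "q \<in> insert x Q" for p q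
    using zyz[OF that] by (simp add: z_def)
  then show ?case by blast
qed

section \<open>The free algebra\<close>

notation fa_mult (infixl "\<odot>" 70)

lemma fa_mult_assoc: "(p \<odot> q) \<odot> t = p \<odot> (q \<odot> t)"
  for p q t :: "'g list \<Rightarrow> 'r::{ring,monoid_mult}"
proof
  fix u :: "'g list"
  let ?n = "length u"
  have "((p \<odot> q) \<odot> t) u
      = (\<Sum>k\<le>?n. \<Sum>j\<le>k. p (take j u) * q (drop j (take k u)) * t (drop k u))"
    unfolding fa_mult_def sum_distrib_right
    by (intro sum.cong refl) (auto simp: min_def)
  also have "\<dots> = (\<Sum>(k,j)\<in>Sigma {..?n} (\<lambda>k. {..k}). p (take j u) * q (drop j (take k u)) * t (drop k u))"
    by (simp add: sum.Sigma)
  \<comment> \<open>Both sides sum over the ways to cut \<open>u\<close> into three pieces: by the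
    two cut positions \<open>j \<le> k\<close>, or by the first cut \<open>j\<close> and the length
    \<open>l = k - j\<close> of the middle piece.\<close>
  also have "\<dots> = (\<Sum>(j,l)\<in>Sigma {..?n} (\<lambda>j. {..?n - j}). p (take j u) * (q (take l (drop j u)) * t (drop l (drop j u))))"
    by (rule sum.reindex_bij_witness[of _ "\<lambda>(j,l). (j + l, j)" "\<lambda>(k,j). (j, k - j)"])
      (auto simp: mult.assoc drop_take add.commute)
  also have "\<dots> = (p \<odot> (q \<odot> t)) u"
    unfolding fa_mult_def sum_distrib_left by (simp add: sum.Sigma)
  finally show "((p \<odot> q) \<odot> t) u = (p \<odot> (q \<odot> t)) u" .
qed

lemma fa_mult_add_left: "(p + q) \<odot> t = p \<odot> t + q \<odot> t"
  by (auto simp: fa_mult_def fun_eq_iff algebra_simps sum.distrib)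

lemma fa_mult_add_right: "t \<odot> (p + q) = t \<odot> p + t \<odot> q"
  by (auto simp: fa_mult_def fun_eq_iff algebra_simps sum.distrib)

lemma fa_mult_diff_left: "(p - q) \<odot> t = p \<odot> t - q \<odot> t"
  by (auto simp: fa_mult_def fun_eq_iff algebra_simps sum_subtractf)

lemma fa_mult_diff_right: "t \<odot> (p - q) = t \<odot> p - t \<odot> q"
  by (auto simp: fa_mult_def fun_eq_iff algebra_simps sum_subtractf)

lemma fa_mult_zero [simp]: "0 \<odot> p = 0" "p \<odot> 0 = 0"
  by (auto simp: fa_mult_def fun_eq_iff)

lemma fa_mult_sum_left: "(\<Sum>i\<in>A. f i) \<odot> t = (\<Sum>i\<in>A. f i \<odot> t)"
  by (induction A rule: infinite_finite_induct) (simp_all add: fa_mult_add_left del: plus_fun_apply zero_fun_apply)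

lemma fa_mult_sum_right: "t \<odot> (\<Sum>i\<in>A. f i) = (\<Sum>i\<in>A. t \<odot> f i)"
  by (induction A rule: infinite_finite_induct) (simp_all add: fa_mult_add_right del: plus_fun_apply zero_fun_apply)

lemma fa_smult_mult: "fa_smult c p \<odot> q = fa_smult c (p \<odot> q)"
  by (auto simp: fa_mult_def fa_smult_def sum_distrib_left mult.assoc)

lemma fa_smult_simps:
  "fa_smult c (p + q) = fa_smult c p + fa_smult c q"
  "fa_smult c (p - q) = fa_smult c p - fa_smult c q"
  "fa_smult (c + d) p = fa_smult c p + fa_smult d p"
  "fa_smult c (fa_smult d p) = fa_smult (c * d) p"
  "fa_smult 0 p = 0" "fa_smult c 0 = 0" "fa_smult 1 p = p"
  by (auto simp: fa_smult_def fun_eq_iff algebra_simps)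

lemma fa_smult_minus_one: "fa_smult (- 1) p = - p"
  by (auto simp: fa_smult_def fun_eq_iff)

lemma fa_smult_sum_left: "fa_smult (\<Sum>i\<in>A. c i) p = (\<Sum>i\<in>A. fa_smult (c i) p)"
  by (induction A rule: infinite_finite_induct) (simp_all add: fa_smult_simps del: plus_fun_apply zero_fun_apply)

lemma fa_smult_sum_right: "fa_smult c (\<Sum>i\<in>A. f i) = (\<Sum>i\<in>A. fa_smult c (f i))"
  by (induction A rule: infinite_finite_induct) (simp_all add: fa_smult_simps del: plus_fun_apply zero_fun_apply)

lemma fa_mono_mult: "fa_mono u \<odot> fa_mono v = fa_mono (u @ v)"
proof
  fix x
  have *: "fa_mono u (take k x) * fa_mono v (drop k x) =
      (if k = length u then fa_mono (u @ v) x else (0::'b))" if "k \<le> length x" for k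
  proof -
    have "fa_mono u (take k x) * fa_mono v (drop k x) =
        (if take k x = u \<and> drop k x = v then 1 else (0::'b))"
      by (simp add: fa_mono_def)
    also have "take k x = u \<and> drop k x = v \<longleftrightarrow> k = length u \<and> x = u @ v"
      using that by (metis append_eq_conv_conj append_take_drop_id length_take min.absorb2)
    finally show ?thesis by (simp only: fa_mono_def) presburger
  qed
  have "(fa_mono u \<odot> fa_mono v) x = (\<Sum>k\<le>length x. if k = length u then fa_mono (u @ v) x else (0::'b))"
    unfolding fa_mult_def using * by (intro sum.cong) auto
  also have "\<dots> = fa_mono (u @ v) x"
    by (auto simp: fa_mono_def)
  finally show "(fa_mono u \<odot> fa_mono v) x = (fa_mono (u @ v) x :: 'b)" .
qed

lemma fa_mult_nonzeroE:
  assumes "(p \<odot> q) u \<noteq> 0"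
  obtains a b where "u = a @ b" "p a \<noteq> 0" "q b \<noteq> 0"
proof -
  obtain k where "p (take k u) * q (drop k u) \<noteq> 0"
    using assms unfolding fa_mult_def by (metis (no_types, lifting) sum.neutral)
  then show thesis
    by (intro that[of "take k u" "drop k u"]) auto
qed

lemma FA_zero: "0 \<in> FA V E1"
  by (simp add: FA_def)

lemma FA_add: "p \<in> FA V E1 \<Longrightarrow> q \<in> FA V E1 \<Longrightarrow> p + q \<in> FA V E1"
proof -
  assume "p \<in> FA V E1" "q \<in> FA V E1"
  moreover have "{u. (p + q) u \<noteq> 0} \<subseteq> {u. p u \<noteq> 0} \<union> {u. q u \<noteq> 0}" by auto
  ultimately show ?thesis
    unfolding FA_def by (auto intro: finite_subset)
qed

lemma FA_smult:
  assumes "p \<in> FA V E1"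
  shows "fa_smult c p \<in> FA V E1"
proof -
  have *: "{u. fa_smult c p u \<noteq> 0} \<subseteq> {u. p u \<noteq> 0}" by (auto simp: fa_smult_def)
  then have "finite {u. fa_smult c p u \<noteq> 0}"
    by (rule finite_subset) (use assms in \<open>simp add: FA_def\<close>)
  with * show ?thesis using assms unfolding FA_def by blast
qed

lemma FA_diff: "p \<in> FA V E1 \<Longrightarrow> q \<in> FA V E1 \<Longrightarrow> p - q \<in> FA V E1"
  using FA_add[of p V E1 "fa_smult (- 1) q"] FA_smult[of q V E1 "- 1"]
  by (simp add: fa_smult_minus_one)

lemma FA_sum: "(\<And>i. i \<in> A \<Longrightarrow> f i \<in> FA V E1) \<Longrightarrow> (\<Sum>i\<in>A. f i) \<in> FA V E1"
  by (induction A rule: infinite_finite_induct) (simp_all add: FA_zero FA_add del: plus_fun_apply zero_fun_apply)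

lemma FA_mult: "p \<in> FA V E1 \<Longrightarrow> q \<in> FA V E1 \<Longrightarrow> p \<odot> q \<in> FA V E1"
proof -
  assume *: "p \<in> FA V E1" "q \<in> FA V E1"
  have "{u. (p \<odot> q) u \<noteq> 0} \<subseteq> (\<lambda>(a,b). a @ b) ` ({u. p u \<noteq> 0} \<times> {u. q u \<noteq> 0})"
    by (fastforce elim: fa_mult_nonzeroE)
  moreover have "finite \<dots>" using * by (auto simp: FA_def)
  ultimately have "finite {u. (p \<odot> q) u \<noteq> 0}" by (rule finite_subset)
  moreover have "u \<noteq> [] \<and> set u \<subseteq> gens V E1" if "(p \<odot> q) u \<noteq> 0" for u
    using that * by (elim fa_mult_nonzeroE) (auto simp: FA_def)
  ultimately show ?thesis by (simp add: FA_def)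
qed

lemma FA_mono: "u \<noteq> [] \<Longrightarrow> set u \<subseteq> gens V E1 \<Longrightarrow> fa_mono u \<in> FA V E1"
  by (auto simp: FA_def fa_mono_def)

text \<open>Scalars act from the left and need not commute with each other, so a scalar can be
  pulled past a left factor only if the coefficients of that factor are central. Everything built
  from monomials by differences, sums and products qualifies.\<close>

definition central_coeffs :: "('g list \<Rightarrow> 'r::{ring,monoid_mult}) \<Rightarrow> bool" where
  "central_coeffs p \<longleftrightarrow> (\<forall>u c. p u * c = c * p u)"

lemma central_coeffs_mono: "central_coeffs (fa_mono u)"
  by (simp add: central_coeffs_def fa_mono_def)

lemma central_coeffs_diff: "central_coeffs p \<Longrightarrow> central_coeffs q \<Longrightarrow> central_coeffs (p - q)"
  by (simp add: central_coeffs_def left_diff_distrib right_diff_distrib)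

lemma central_coeffs_sum: "(\<And>i. i \<in> A \<Longrightarrow> central_coeffs (f i)) \<Longrightarrow> central_coeffs (\<Sum>i\<in>A. f i)"
  by (induction A rule: infinite_finite_induct)
    (simp_all add: central_coeffs_def distrib_left distrib_right)

lemma central_coeffs_mult:
  assumes "central_coeffs p" "central_coeffs q"
  shows "central_coeffs (p \<odot> q)"
proof -
  have "p a * q b * c = c * (p a * q b)" for a b c
  proof -
    have "p a * q b * c = p a * c * q b"
      using assms(2) by (simp add: central_coeffs_def mult.assoc)
    also have "p a * c = c * p a"
      using assms(1) by (simp add: central_coeffs_def)
    finally show ?thesis by (simp add: mult.assoc)
  qed
  then show ?thesis
    by (simp add: central_coeffs_def fa_mult_def sum_distrib_left sum_distrib_right)
qed

lemma central_coeffs_smult: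
  assumes "central_coeffs p"
  shows "p \<odot> fa_smult c q = fa_smult c (p \<odot> q)"
proof -
  have "p a * (c * x) = c * (p a * x)" for a x
    using assms unfolding central_coeffs_def by (metis mult.assoc)
  then show ?thesis
    by (simp add: fa_mult_def fa_smult_def sum_distrib_left fun_eq_iff)
qed

section \<open>A functional on the free algebra\<close>

text \<open>A word acts on boundary paths as a partial map, so its matrix coefficients are 0 or 1.
  The predicate \<open>h\<close> selects the words whose coefficient is 1 at a fixed
  position.\<close>

definition coeff_sum :: "('g list \<Rightarrow> bool) \<Rightarrow> ('g list \<Rightarrow> 'r::{ring,monoid_mult}) \<Rightarrow> 'r" where
  "coeff_sum h p = (\<Sum>u | p u \<noteq> 0. if h u then p u else 0)"

lemma coeff_sum_superset:
  assumes "finite A" "{u. p u \<noteq> 0} \<subseteq> A"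
  shows "coeff_sum h p = (\<Sum>u\<in>A. if h u then p u else 0)"
  unfolding coeff_sum_def by (rule sum.mono_neutral_left) (use assms in auto)

lemma coeff_sum_add:
  assumes "finite {u. p u \<noteq> 0}" "finite {u. q u \<noteq> 0}"
  shows "coeff_sum h (p + q) = coeff_sum h p + coeff_sum h q"
proof -
  let ?A = "{u. p u \<noteq> 0} \<union> {u. q u \<noteq> 0}"
  have "finite ?A" "{u. (p + q) u \<noteq> 0} \<subseteq> ?A" using assms by auto
  then show ?thesis
    by (subst (1 2 3) coeff_sum_superset[of ?A]) (auto simp: sum.distrib[symmetric] intro!: sum.cong)
qed

lemma coeff_sum_zero: "coeff_sum h 0 = 0"
  by (simp add: coeff_sum_def)

lemma coeff_sum_smult:
  assumes "finite {u. p u \<noteq> 0}"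
  shows "coeff_sum h (fa_smult c p) = c * coeff_sum h p"
proof -
  have "{u. fa_smult c p u \<noteq> 0} \<subseteq> {u. p u \<noteq> 0}" by (auto simp: fa_smult_def)
  then show ?thesis
    using assms
    by (subst (1 2) coeff_sum_superset[of "{u. p u \<noteq> 0}"])
      (auto simp: sum_distrib_left fa_smult_def intro!: sum.cong)
qed

lemma coeff_sum_mono: "coeff_sum h (fa_mono u) = (if h u then 1 else 0)"
  by (subst coeff_sum_superset[of "{u}"]) (auto simp: fa_mono_def)

lemma coeff_sum_mult:
  assumes "finite {u. p u \<noteq> 0}" "finite {u. q u \<noteq> 0}"
  shows "coeff_sum h (p \<odot> q) = (\<Sum>a | p a \<noteq> 0. \<Sum>b | q b \<noteq> 0. if h (a @ b) then p a * q b else 0)"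
proof -
  let ?A = "{u. p u \<noteq> 0}" and ?B = "{u. q u \<noteq> 0}"
  let ?W = "(\<lambda>(a,b). a @ b) ` (?A \<times> ?B)"
  let ?j = "\<lambda>(a,b). (a @ b, length a)"
  have "{u. (p \<odot> q) u \<noteq> 0} \<subseteq> ?W"
    by (fastforce elim: fa_mult_nonzeroE)
  then have "coeff_sum h (p \<odot> q) = (\<Sum>u\<in>?W. if h u then (p \<odot> q) u else 0)"
    using assms by (intro coeff_sum_superset) auto
  also have "\<dots> = (\<Sum>u\<in>?W. \<Sum>k\<le>length u. if h u then p (take k u) * q (drop k u) else 0)"
    by (intro sum.cong) (auto simp: fa_mult_def)
  also have "\<dots> = (\<Sum>(u,k)\<in>Sigma ?W (\<lambda>u. {..length u}). if h u then p (take k u) * q (drop k u) else 0)"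
    using assms by (simp add: sum.Sigma)
  \<comment> \<open>Different pairs of words may have the same concatenation. Recording the cut
    position as well makes \<open>?j\<close> injective, and cuts outside its image contribute
    zero.\<close>
  also have "\<dots> = (\<Sum>(u,k)\<in>?j ` (?A \<times> ?B). if h u then p (take k u) * q (drop k u) else 0)"
  proof (rule sum.mono_neutral_right, goal_cases)
    case 3
    have "(u, k) \<in> ?j ` (?A \<times> ?B)"
      if "k \<le> length u" "p (take k u) \<noteq> 0" "q (drop k u) \<noteq> 0" for u k
      using that by (intro image_eqI[of _ _ "(take k u, drop k u)"]) auto
    then have "p (take k u) * q (drop k u) = 0"
      if "(u, k) \<in> Sigma ?W (\<lambda>u. {..length u}) - ?j ` (?A \<times> ?B)" for u k
      using that by (metis (no_types, lifting) DiffD1 DiffD2 SigmaD2 atMost_iff mult_zero_left mult_zero_right)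
    then show ?case
      by (intro ballI, simp only: split_paired_all prod.case) simp
  qed (use assms in auto)
  also have "\<dots> = (\<Sum>(a,b)\<in>?A \<times> ?B. if h (a @ b) then p a * q b else 0)"
    by (subst sum.reindex) (auto simp: inj_on_def intro!: sum.cong)
  also have "\<dots> = (\<Sum>a\<in>?A. \<Sum>b\<in>?B. if h (a @ b) then p a * q b else 0)"
    using assms by (simp add: sum.Sigma)
  finally show ?thesis .
qed

text \<open>With the word \<open>a\<close> fixed, what remains is a functional of the same kind on
  \<open>q\<close>. This and the mirror image below carry the vanishing on the relations over to the
  two-sided ideal.\<close>

lemma coeff_sum_mult_left:
  assumes "finite {u. p u \<noteq> 0}" "finite {u. q u \<noteq> 0}"
  shows "coeff_sum h (p \<odot> q) = (\<Sum>a | p a \<noteq> 0. p a * coeff_sum (\<lambda>b. h (a @ b)) q)"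
  unfolding coeff_sum_mult[OF assms] unfolding coeff_sum_def sum_distrib_left
  by (intro sum.cong) auto

lemma coeff_sum_mult_right:
  assumes "finite {u. p u \<noteq> 0}" "finite {u. q u \<noteq> 0}"
  shows "coeff_sum h (p \<odot> q) = (\<Sum>b | q b \<noteq> 0. coeff_sum (\<lambda>a. h (a @ b)) p * q b)"
  unfolding coeff_sum_mult[OF assms] unfolding coeff_sum_def sum_distrib_right
  by (subst sum.swap) (intro sum.cong; auto)

section \<open>The action on boundary paths\<close>

text \<open>A codatatype holds finite paths, with their end vertex, and infinite paths in one
  type.\<close>

codatatype ('v,'e) bpath = Stop 'v | Step 'e "('v,'e) bpath"

definition bsrc :: "('e \<Rightarrow> 'v) \<Rightarrow> ('v,'e) bpath \<Rightarrow> 'v" where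
  "bsrc s \<xi> = (case \<xi> of Stop v \<Rightarrow> v | Step a _ \<Rightarrow> s a)"

lemma bsrc_simps [simp]: "bsrc s (Stop v) = v" "bsrc s (Step a \<xi>) = s a"
  by (simp_all add: bsrc_def)

coinductive boundary :: "'v set \<Rightarrow> 'e set \<Rightarrow> ('e \<Rightarrow> 'v) \<Rightarrow> ('e \<Rightarrow> 'v) \<Rightarrow> ('v,'e) bpath \<Rightarrow> bool"
  for V E1 s r where
  stop: "v \<in> V \<Longrightarrow> v \<notin> Reg V E1 s \<Longrightarrow> boundary V E1 s r (Stop v)"
| step: "a \<in> E1 \<Longrightarrow> bsrc s \<xi> = r a \<Longrightarrow> boundary V E1 s r \<xi> \<Longrightarrow> boundary V E1 s r (Step a \<xi>)"

inductive_simps boundary_simps [simp]: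
  "boundary V E1 s r (Stop v)" "boundary V E1 s r (Step a \<xi>)"

primcorec bpath_from :: "('v \<Rightarrow> bool) \<Rightarrow> ('v \<Rightarrow> 'e) \<Rightarrow> ('e \<Rightarrow> 'v) \<Rightarrow> 'v \<Rightarrow> ('v,'e) bpath" where
  "bpath_from R f r v = (if R v then Step (f v) (bpath_from R f r (r (f v))) else Stop v)"

text \<open>\<open>None\<close> is the zero vector of the free module. Edges prepend themselves,
  ghost edges remove a first edge, and vertices are projections.\<close>

fun act :: "('e \<Rightarrow> 'v) \<Rightarrow> ('e \<Rightarrow> 'v) \<Rightarrow> ('v,'e) gen \<Rightarrow> ('v,'e) bpath \<Rightarrow> ('v,'e) bpath option" where
  "act s r (Vx v) \<xi> = (if bsrc s \<xi> = v then Some \<xi> else None)"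
| "act s r (Ed a) \<xi> = (if bsrc s \<xi> = r a then Some (Step a \<xi>) else None)"
| "act s r (Gh a) \<xi> = (case \<xi> of Stop v \<Rightarrow> None | Step b \<zeta> \<Rightarrow> if b = a then Some \<zeta> else None)"

fun acts :: "('e \<Rightarrow> 'v) \<Rightarrow> ('e \<Rightarrow> 'v) \<Rightarrow> ('v,'e) gen list \<Rightarrow> ('v,'e) bpath \<Rightarrow> ('v,'e) bpath option" where
  "acts s r [] \<xi> = Some \<xi>"
| "acts s r (g # u) \<xi> = Option.bind (acts s r u \<xi>) (act s r g)"

lemma acts_append: "acts s r (u @ v) \<xi> = Option.bind (acts s r v \<xi>) (acts s r u)"
  by (induction u) (auto split: bind_splits)

text \<open>Partial injectivity yields at most one preimage of a path under a word. It is used when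
  an element of the ideal is multiplied from the left.\<close>

lemma act_inj: "act s r g \<xi> = Some \<eta> \<Longrightarrow> act s r g \<zeta> = Some \<eta> \<Longrightarrow> \<xi> = \<zeta>"
  by (cases g) (auto split: if_splits bpath.splits)

lemma acts_inj: "acts s r u \<xi> = Some \<eta> \<Longrightarrow> acts s r u \<zeta> = Some \<eta> \<Longrightarrow> \<xi> = \<zeta>"
  by (induction u arbitrary: \<eta>) (auto split: bind_splits dest: act_inj)

locale digraph =
  fixes V :: "'v set" and E1 :: "'e set" and s r :: "'e \<Rightarrow> 'v"
  assumes source_in: "a \<in> E1 \<Longrightarrow> s a \<in> V" and range_in: "a \<in> E1 \<Longrightarrow> r a \<in> V"
begin

text \<open>Follow a chosen outgoing edge from each regular vertex and stop at the first vertex that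
  is not regular; if there is none, the path is infinite.\<close>

lemma bpath_exists:
  assumes "v \<in> V"
  obtains \<xi> where "boundary V E1 s r \<xi>" "bsrc s \<xi> = v"
proof
  define R where "R = (\<lambda>v. v \<in> Reg V E1 s)"
  define f where "f = (\<lambda>v. SOME a. a \<in> E1 \<and> s a = v)"
  have f: "f v \<in> E1 \<and> s (f v) = v" if "R v" for v
    unfolding f_def by (rule someI_ex) (use that in \<open>auto simp: R_def Reg_def\<close>)
  let ?\<xi> = "\<lambda>v. bpath_from R f r v"
  show src: "bsrc s (?\<xi> v) = v" for v
    using f by (subst bpath_from.code) auto
  have "\<exists>v\<in>V. \<xi> = ?\<xi> v \<Longrightarrow> boundary V E1 s r \<xi>" for \<xi>
  proof (coinduction arbitrary: \<xi>)
    case boundary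
    then obtain v where v: "v \<in> V" "\<xi> = ?\<xi> v" by blast
    show ?case
    proof (cases "R v")
      case True
      then have "\<xi> = Step (f v) (?\<xi> (r (f v)))" using v(2) bpath_from.code by metis
      then show ?thesis using f[OF True] src range_in by auto
    next
      case False
      then have "\<xi> = Stop v" using v(2) bpath_from.code by metis
      then show ?thesis using False v(1) by (auto simp: R_def)
    qed
  qed
  then show "boundary V E1 s r (?\<xi> v)" using assms by blast
qed

lemma act_boundary:
  "g \<in> gens V E1 \<Longrightarrow> boundary V E1 s r \<xi> \<Longrightarrow> act s r g \<xi> = Some \<eta> \<Longrightarrow> boundary V E1 s r \<eta>"
  by (cases g) (auto simp: gens_def split: if_splits bpath.splits)

lemma acts_boundary:
  "set u \<subseteq> gens V E1 \<Longrightarrow> boundary V E1 s r \<xi> \<Longrightarrow> acts s r u \<xi> = Some \<eta> \<Longrightarrow> boundary V E1 s r \<eta>"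
  by (induction u arbitrary: \<eta>) (auto split: bind_splits dest: act_boundary)

lemma lpa_rels_FA: "lpa_rels V E1 s r \<subseteq> FA V E1"
  unfolding lpa_rels_def
  by (auto intro!: FA_diff FA_sum FA_zero FA_mono simp: gens_def source_in range_in Reg_def
      simp del: plus_fun_apply zero_fun_apply minus_apply)

lemma lpa_ideal_FA: "x \<in> lpa_ideal V E1 s r \<Longrightarrow> x \<in> FA V E1"
  by (induction rule: lpa_ideal.induct)
    (use lpa_rels_FA in \<open>auto intro: FA_zero FA_add FA_smult FA_mult
      simp del: plus_fun_apply zero_fun_apply\<close>)

text \<open>Matrix coefficients of the representation of the Leavitt path algebra on the free module
  over the boundary paths.\<close>

abbreviation entry :: "('v,'e) bpath \<Rightarrow> ('v,'e) bpath \<Rightarrow> (('v,'e) gen list \<Rightarrow> 'k::{ring,monoid_mult}) \<Rightarrow> 'k" where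
  "entry \<xi> \<zeta> \<equiv> coeff_sum (\<lambda>u. acts s r u \<zeta> = Some \<xi>)"

lemma FA_finite: "p \<in> FA V E1 \<Longrightarrow> finite {u. p u \<noteq> 0}"
  by (simp add: FA_def)

lemma coeff_sum_False: "coeff_sum (\<lambda>u. False) p = 0"
  by (simp add: coeff_sum_def)

lemma coeff_sum_diff:
  assumes "p \<in> FA V E1" "q \<in> FA V E1"
  shows "coeff_sum h (p - q) = coeff_sum h p - coeff_sum h q"
proof -
  have "coeff_sum h ((p - q) + q) = coeff_sum h (p - q) + coeff_sum h q"
    using assms by (intro coeff_sum_add FA_finite[OF FA_diff] FA_finite)
  then show ?thesis by (simp del: plus_fun_apply minus_apply)
qed

lemma coeff_sum_sum:
  assumes "\<And>i. i \<in> A \<Longrightarrow> f i \<in> FA V E1"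
  shows "coeff_sum h (\<Sum>i\<in>A. f i) = (\<Sum>i\<in>A. coeff_sum h (f i))"
  using assms
proof (induction A rule: infinite_finite_induct)
  case (insert x A)
  then show ?case
    using coeff_sum_add[of "f x" "sum f A" h] FA_finite[OF FA_sum[of A f]] FA_finite[of "f x"]
    by (simp del: plus_fun_apply)
qed (simp_all add: coeff_sum_zero del: zero_fun_apply)

text \<open>Each relation holds for the operators on boundary paths. The summation relation at a
  regular \<open>v\<close> holds because a boundary path starting at \<open>v\<close> cannot stop
  there and hence begins with exactly one edge out of \<open>v\<close>.\<close>

lemma entry_rels:
  fixes x :: "('v,'e) gen list \<Rightarrow> 'k::{ring,monoid_mult}"
  assumes "x \<in> lpa_rels V E1 s r" and \<zeta>: "boundary V E1 s r \<zeta>"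
  shows "entry \<xi> \<zeta> x = 0"
proof -
  have mono_diff: "entry \<xi> \<zeta> (fa_mono u - fa_mono u' :: _ \<Rightarrow> 'k) = 0"
    if "u \<noteq> []" "u' \<noteq> []" "set u \<subseteq> gens V E1" "set u' \<subseteq> gens V E1"
      "acts s r u \<zeta> = acts s r u' \<zeta>" for u u'
    using that by (simp add: coeff_sum_diff FA_mono coeff_sum_mono)
  have mono_zero: "entry \<xi> \<zeta> (fa_mono u :: _ \<Rightarrow> 'k) = 0" if "acts s r u \<zeta> = None" for u
    using that by (simp add: coeff_sum_mono)
  have CK2: "entry \<xi> \<zeta> ((\<Sum>a\<in>{a \<in> E1. s a = v}. fa_mono [Ed a, Gh a]) - fa_mono [Vx v] :: _ \<Rightarrow> 'k) = 0"
    if v: "v \<in> Reg V E1 s" for v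
  proof -
    let ?A = "{a \<in> E1. s a = v}"
    have "entry \<xi> \<zeta> (\<Sum>a\<in>?A. fa_mono [Ed a, Gh a] :: _ \<Rightarrow> 'k)
        = (\<Sum>a\<in>?A. if acts s r [Ed a, Gh a] \<zeta> = Some \<xi> then 1 else 0)"
      by (subst coeff_sum_sum) (auto simp: coeff_sum_mono gens_def intro!: FA_mono)
    \<comment> \<open>\<open>a a*\<close> fixes the paths that begin with \<open>a\<close> and
      annihilates all others. Prepending \<open>a\<close> again is possible because
      \<open>\<zeta>\<close> is a boundary path.\<close>
    also have "\<dots> = (\<Sum>a\<in>?A. if \<zeta> = \<xi> \<and> (\<exists>\<eta>. \<zeta> = Step a \<eta>) then 1 else 0)"
      using \<zeta> by (intro sum.cong refl) (auto split: bpath.splits if_splits)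
    also have "\<dots> = (if acts s r [Vx v] \<zeta> = Some \<xi> then 1 else 0)"
    proof (cases \<zeta>)
      case (Stop u)
      then show ?thesis using \<zeta> v by auto
    next
      case (Step b \<eta>)
      then have "b \<in> E1" using \<zeta> by simp
      then show ?thesis using Step v by (auto simp: Reg_def intro!: sum.neutral)
    qed
    finally show ?thesis
      using v by (subst coeff_sum_diff)
        (auto simp: coeff_sum_mono gens_def Reg_def intro!: FA_mono FA_sum)
  qed
  show ?thesis
    using assms(1) unfolding lpa_rels_def
    using \<zeta>
    by (elim UnE) (auto intro!: mono_diff mono_zero CK2 simp: gens_def source_in range_in
      simp del: minus_apply split: bpath.splits)
qed

lemma entry_ideal:
  assumes "x \<in> lpa_ideal V E1 s r" and "boundary V E1 s r \<zeta>"
  shows "entry \<xi> \<zeta> x = 0"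
  using assms
proof (induction arbitrary: \<zeta> \<xi> rule: lpa_ideal.induct)
  case (rel x)
  then show ?case by (rule entry_rels)
next
  case zero
  show ?case by (rule coeff_sum_zero)
next
  case (add x y)
  then show ?case by (simp add: coeff_sum_add FA_finite lpa_ideal_FA del: plus_fun_apply)
next
  case (smult x c)
  then show ?case by (simp add: coeff_sum_smult FA_finite lpa_ideal_FA)
next
  case (lmult x p)
  \<comment> \<open>A left factor \<open>a\<close> replaces the row \<open>\<xi>\<close> by its
    unique preimage under \<open>a\<close>, if there is one; otherwise the entry vanishes.\<close>
  have "coeff_sum (\<lambda>b. acts s r (a @ b) \<zeta> = Some \<xi>) x = 0" for a
  proof (cases "\<exists>\<eta>. acts s r a \<eta> = Some \<xi>")
    case True
    then obtain \<eta> where "acts s r a \<eta> = Some \<xi>" by blast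
    then have "(\<lambda>b. acts s r (a @ b) \<zeta> = Some \<xi>) = (\<lambda>b. acts s r b \<zeta> = Some \<eta>)"
      by (auto simp: acts_append fun_eq_iff bind_eq_Some_conv dest: acts_inj)
    then show ?thesis using lmult.IH[OF lmult.prems] by simp
  next
    case False
    then show ?thesis by (simp add: acts_append bind_eq_Some_conv coeff_sum_False)
  qed
  then show ?case
    using lmult by (subst coeff_sum_mult_left) (auto intro: FA_finite lpa_ideal_FA)
next
  case (rmult x p)
  \<comment> \<open>A right factor \<open>b\<close> replaces the column \<open>\<zeta>\<close> by
    its image, which is again a boundary path since \<open>b\<close> consists of generators of the
    graph.\<close>
  have "coeff_sum (\<lambda>a. acts s r (a @ b) \<zeta> = Some \<xi>) x = 0" if "p b \<noteq> 0" for b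
  proof (cases "acts s r b \<zeta>")
    case None
    then show ?thesis by (simp add: acts_append coeff_sum_False)
  next
    case (Some \<eta>)
    have "set b \<subseteq> gens V E1" using that rmult.hyps by (simp add: FA_def)
    then have "boundary V E1 s r \<eta>" using acts_boundary Some rmult.prems by blast
    then show ?thesis using rmult.IH Some by (simp add: acts_append)
  qed
  then show ?case
    using rmult by (subst coeff_sum_mult_right) (auto intro: FA_finite lpa_ideal_FA)
qed

lemma vnr_of_regular_scalars:
  fixes a :: "'k::{ring,monoid_mult}"
  assumes "v \<in> V" "y \<in> FA V E1"
    and "fa_smult a (fa_mono [Vx v]) - fa_smult a (fa_mono [Vx v]) \<odot> y \<odot> fa_smult a (fa_mono [Vx v])
      \<in> lpa_ideal V E1 s r" (is "?x - ?x \<odot> y \<odot> ?x \<in> _")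
  shows "\<exists>b. a = a * b * a"
proof (cases "a = 0")
  case False
  obtain \<xi> where \<xi>: "boundary V E1 s r \<xi>" "bsrc s \<xi> = v"
    using bpath_exists[OF assms(1)] .
  have x: "?x \<in> FA V E1"
    using assms(1) by (auto intro!: FA_smult FA_mono simp: gens_def)
  \<comment> \<open>Here \<open>a\<close> being nonzero matters: the sums over the support of
    \<open>?x\<close> then have exactly one term.\<close>
  have supp: "{u. ?x u \<noteq> 0} = {[Vx v]}"
    using False by (auto simp: fa_smult_def fa_mono_def)
  have xv: "?x [Vx v] = a" by (simp add: fa_smult_def fa_mono_def)
  have "entry \<xi> \<xi> (?x \<odot> y \<odot> ?x) = entry \<xi> \<xi> (?x \<odot> y) * a"
    using x assms(2) \<xi>
    by (subst coeff_sum_mult_right) (simp_all add: FA_finite FA_mult supp xv acts_append)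
  also have "entry \<xi> \<xi> (?x \<odot> y) = a * entry \<xi> \<xi> y"
  proof -
    have "(\<lambda>b. acts s r ([Vx v] @ b) \<xi> = Some \<xi>) = (\<lambda>b. acts s r b \<xi> = Some \<xi>)"
      using \<xi> by (auto simp: bind_eq_Some_conv fun_eq_iff split: if_splits)
    then show ?thesis
      using x assms(2) by (subst coeff_sum_mult_left) (simp_all add: FA_finite supp xv)
  qed
  finally have "entry \<xi> \<xi> (?x \<odot> y \<odot> ?x) = a * entry \<xi> \<xi> y * a" .
  moreover have "entry \<xi> \<xi> ?x = a"
    using \<xi> assms(1) by (subst coeff_sum_smult) (auto simp: coeff_sum_mono gens_def intro!: FA_finite FA_mono)
  moreover have "entry \<xi> \<xi> (?x - ?x \<odot> y \<odot> ?x) = 0"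
    using entry_ideal[OF assms(3) \<xi>(1)] .
  ultimately have "a - a * entry \<xi> \<xi> y * a = 0"
    using x assms(2) by (simp add: coeff_sum_diff FA_mult)
  then show ?thesis by (metis eq_iff_diff_eq_0)
qed auto


section \<open>Congruence modulo the defining ideal\<close>

text \<open>Membership in \<open>FA\<close> is built in because the ideal absorbs products only with
  elements of \<open>FA\<close>; congruences can then be multiplied without separate side
  conditions.\<close>

definition eqv :: "(('v,'e) gen list \<Rightarrow> 'k::{ring,monoid_mult}) \<Rightarrow> (('v,'e) gen list \<Rightarrow> 'k) \<Rightarrow> bool"
    (infix "\<approx>" 50) where
  "x \<approx> y \<longleftrightarrow> x \<in> FA V E1 \<and> y \<in> FA V E1 \<and> x - y \<in> lpa_ideal V E1 s r"

lemma eqv_FA: "x \<approx> y \<Longrightarrow> x \<in> FA V E1" "x \<approx> y \<Longrightarrow> y \<in> FA V E1"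
  by (simp_all add: eqv_def)

lemma eqv_refl: "x \<in> FA V E1 \<Longrightarrow> x \<approx> x"
  using lpa_ideal.zero by (simp add: eqv_def)

lemma lpa_ideal_uminus: "x \<in> lpa_ideal V E1 s r \<Longrightarrow> - x \<in> lpa_ideal V E1 s r"
  using lpa_ideal.smult[of x V E1 s r "- 1"] by (simp add: fa_smult_minus_one)

lemma eqv_sym: "x \<approx> y \<Longrightarrow> y \<approx> x"
  using lpa_ideal_uminus[of "x - y"] by (simp add: eqv_def del: minus_apply uminus_apply)

lemma eqv_trans [trans]: "x \<approx> y \<Longrightarrow> y \<approx> z \<Longrightarrow> x \<approx> z"
  using lpa_ideal.add[of "x - y" V E1 s r "y - z"] by (simp add: eqv_def del: minus_apply plus_fun_apply)

lemma eq_eqv_trans [trans]: "x = y \<Longrightarrow> y \<approx> z \<Longrightarrow> x \<approx> z" "x \<approx> y \<Longrightarrow> y = z \<Longrightarrow> x \<approx> z"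
  by simp_all

lemma eqv_add: "x \<approx> y \<Longrightarrow> x' \<approx> y' \<Longrightarrow> x + x' \<approx> y + y'"
  using lpa_ideal.add[of "x - y" V E1 s r "x' - y'"]
  by (simp add: eqv_def FA_add algebra_simps del: minus_apply plus_fun_apply)

lemma eqv_smult: "x \<approx> y \<Longrightarrow> fa_smult c x \<approx> fa_smult c y"
  using lpa_ideal.smult[of "x - y" V E1 s r c]
  by (simp add: eqv_def FA_smult fa_smult_simps del: minus_apply)

lemma eqv_diff: "x \<approx> y \<Longrightarrow> x' \<approx> y' \<Longrightarrow> x - x' \<approx> y - y'"
  using eqv_add[of x y "- x'" "- y'"] eqv_smult[of x' y' "- 1"]
  by (simp add: fa_smult_minus_one del: minus_apply plus_fun_apply uminus_apply)

lemma eqv_sum: "(\<And>i. i \<in> A \<Longrightarrow> f i \<approx> g i) \<Longrightarrow> (\<Sum>i\<in>A. f i) \<approx> (\<Sum>i\<in>A. g i)"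
  by (induction A rule: infinite_finite_induct)
    (simp_all add: eqv_add eqv_refl FA_zero del: plus_fun_apply zero_fun_apply)

lemma eqv_mult:
  assumes "x \<approx> y" "x' \<approx> y'"
  shows "x \<odot> x' \<approx> y \<odot> y'"
proof -
  have "x \<odot> x' - y \<odot> y' = (x - y) \<odot> x' + y \<odot> (x' - y')"
    by (simp add: fa_mult_diff_left fa_mult_diff_right del: plus_fun_apply minus_apply)
  moreover have "\<dots> \<in> lpa_ideal V E1 s r"
    using assms by (intro lpa_ideal.add lpa_ideal.rmult lpa_ideal.lmult) (auto simp: eqv_def)
  ultimately show ?thesis
    using assms by (simp add: eqv_def FA_mult)
qed

lemma eqv_mult_left: "z \<in> FA V E1 \<Longrightarrow> x \<approx> y \<Longrightarrow> z \<odot> x \<approx> z \<odot> y"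
  by (intro eqv_mult eqv_refl)

lemma eqv_mult_right: "z \<in> FA V E1 \<Longrightarrow> x \<approx> y \<Longrightarrow> x \<odot> z \<approx> y \<odot> z"
  by (intro eqv_mult eqv_refl)

section \<open>Products of generators in the Leavitt path algebra\<close>

abbreviation "vx v \<equiv> fa_mono [Vx v]"
abbreviation "ed a \<equiv> fa_mono [Ed a]"
abbreviation "gh a \<equiv> fa_mono [Gh a]"

lemma gen_FA [simp]:
  "v \<in> V \<Longrightarrow> vx v \<in> FA V E1" "a \<in> E1 \<Longrightarrow> ed a \<in> FA V E1" "a \<in> E1 \<Longrightarrow> gh a \<in> FA V E1"
  by (auto intro!: FA_mono simp: gens_def)

lemma eqv_rel: "x - y \<in> lpa_rels V E1 s r \<Longrightarrow> x \<in> FA V E1 \<Longrightarrow> y \<in> FA V E1 \<Longrightarrow> x \<approx> y"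
  by (simp add: eqv_def lpa_ideal.rel)

lemma vx_vx: "v \<in> V \<Longrightarrow> u \<in> V \<Longrightarrow> vx v \<odot> vx u \<approx> (if v = u then vx v else 0)"
  by (rule eqv_rel, unfold fa_mono_mult lpa_rels_def)
    (auto intro!: FA_mono FA_zero simp: gens_def simp del: minus_apply)

lemma ed_relations:
  assumes "a \<in> E1"
  shows src_ed: "vx (s a) \<odot> ed a \<approx> ed a" and ed_rng: "ed a \<odot> vx (r a) \<approx> ed a"
    and rng_gh: "vx (r a) \<odot> gh a \<approx> gh a" and gh_src: "gh a \<odot> vx (s a) \<approx> gh a"
  by (rule eqv_rel, unfold fa_mono_mult lpa_rels_def,
      use assms source_in range_in in \<open>auto intro!: FA_mono simp: gens_def simp del: minus_apply\<close>)+

lemma gh_ed: "a \<in> E1 \<Longrightarrow> b \<in> E1 \<Longrightarrow> gh a \<odot> ed b \<approx> (if a = b then vx (r a) else 0)"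
  by (rule eqv_rel, unfold fa_mono_mult lpa_rels_def)
    (auto intro!: FA_mono FA_zero simp: gens_def range_in simp del: minus_apply)

lemma vx_ed:
  assumes "v \<in> V" "a \<in> E1"
  shows "vx v \<odot> ed a \<approx> (if v = s a then ed a else 0)"
proof -
  have "vx v \<odot> ed a \<approx> (vx v \<odot> vx (s a)) \<odot> ed a"
    unfolding fa_mult_assoc using assms by (intro eqv_mult_left eqv_sym[OF src_ed]) auto
  also have "\<dots> \<approx> (if v = s a then vx v else 0) \<odot> ed a"
    using assms source_in by (intro eqv_mult_right vx_vx) auto
  also have "\<dots> \<approx> (if v = s a then ed a else 0)"
    using assms src_ed by (auto simp: eqv_refl FA_zero)
  finally show ?thesis .
qed

lemma gh_vx:
  assumes "v \<in> V" "a \<in> E1"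
  shows "gh a \<odot> vx v \<approx> (if v = s a then gh a else 0)"
proof -
  have "gh a \<odot> vx v \<approx> (gh a \<odot> vx (s a)) \<odot> vx v"
    using assms by (intro eqv_mult_right eqv_sym[OF gh_src]) auto
  also have "\<dots> \<approx> gh a \<odot> (if s a = v then vx (s a) else 0)"
    unfolding fa_mult_assoc using assms source_in by (intro eqv_mult_left vx_vx) auto
  also have "\<dots> \<approx> (if v = s a then gh a else 0)"
    using assms gh_src by (auto simp: eqv_refl FA_zero)
  finally show ?thesis .
qed

text \<open>The families \<open>B\<close> and \<open>C\<close> are dual up to the local units
  \<open>g q\<close>, so the inner product collapses to a matrix product. Centrality of
  \<open>A\<close> and \<open>B\<close> lets the scalars of the second factor move to the front.
  Absorption of \<open>g q\<close> is required only where both coefficients are nonzero, since it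
  may fail for paths that do not match.\<close>

lemma matrix_product_eqv:
  fixes c :: "'p \<Rightarrow> 'q \<Rightarrow> 'k::{ring,monoid_mult}"
  assumes "finite Q"
    and A: "\<And>p. p \<in> P \<Longrightarrow> A p \<in> FA V E1" "\<And>p. p \<in> P \<Longrightarrow> central_coeffs (A p)"
    and B: "\<And>q. q \<in> Q \<Longrightarrow> B q \<in> FA V E1" "\<And>q. q \<in> Q \<Longrightarrow> central_coeffs (B q)"
    and D: "\<And>t. t \<in> T \<Longrightarrow> D t \<in> FA V E1"
    and orth: "\<And>q q'. q \<in> Q \<Longrightarrow> q' \<in> Q \<Longrightarrow> B q \<odot> C q' \<approx> (if q = q' then g q else 0)"
    and absorb: "\<And>p q t. p \<in> P \<Longrightarrow> q \<in> Q \<Longrightarrow> t \<in> T \<Longrightarrow> c p q \<noteq> 0 \<Longrightarrow> d q t \<noteq> 0 \<Longrightarrow>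
      A p \<odot> (g q \<odot> D t) \<approx> A p \<odot> D t"
  shows "(\<Sum>p\<in>P. \<Sum>q\<in>Q. fa_smult (c p q) (A p \<odot> B q)) \<odot> (\<Sum>q\<in>Q. \<Sum>t\<in>T. fa_smult (d q t) (C q \<odot> D t))
    \<approx> (\<Sum>p\<in>P. \<Sum>t\<in>T. fa_smult (matmul Q c d p t) (A p \<odot> D t))"
proof -
  have term_eqv: "fa_smult (c p q) (A p \<odot> B q) \<odot> fa_smult (d q' t) (C q' \<odot> D t)
      \<approx> (if q = q' then fa_smult (c p q * d q t) (A p \<odot> D t) else 0)"
    if "p \<in> P" "q \<in> Q" "q' \<in> Q" "t \<in> T" for p q q' t
  proof -
    have FA: "A p \<in> FA V E1" "D t \<in> FA V E1" using A D that by auto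
    have "fa_smult (c p q) (A p \<odot> B q) \<odot> fa_smult (d q' t) (C q' \<odot> D t)
      = fa_smult (c p q * d q' t) (A p \<odot> ((B q \<odot> C q') \<odot> D t))"
      using that A B by (simp add: fa_smult_mult central_coeffs_smult fa_smult_simps fa_mult_assoc)
    also have "\<dots> \<approx> fa_smult (c p q * d q' t) (A p \<odot> ((if q = q' then g q else 0) \<odot> D t))"
      using FA that by (intro eqv_smult eqv_mult_left eqv_mult_right orth)
    also have "\<dots> \<approx> (if q = q' then fa_smult (c p q * d q t) (A p \<odot> D t) else 0)"
    proof (cases "q = q'")
      case True
      show ?thesis
      proof (cases "c p q = 0 \<or> d q t = 0")
        case True
        then show ?thesis using \<open>q = q'\<close> by (auto simp: fa_smult_simps eqv_refl FA_zero)
      next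
        case False
        then show ?thesis using \<open>q = q'\<close> that by (auto intro!: eqv_smult absorb)
      qed
    next
      case False
      then show ?thesis by (simp add: fa_smult_simps eqv_refl FA_zero del: zero_fun_apply)
    qed
    finally show ?thesis .
  qed
  have "(\<Sum>p\<in>P. \<Sum>q\<in>Q. fa_smult (c p q) (A p \<odot> B q)) \<odot> (\<Sum>q\<in>Q. \<Sum>t\<in>T. fa_smult (d q t) (C q \<odot> D t))
    = (\<Sum>p\<in>P. \<Sum>q\<in>Q. \<Sum>q'\<in>Q. \<Sum>t\<in>T. fa_smult (c p q) (A p \<odot> B q) \<odot> fa_smult (d q' t) (C q' \<odot> D t))"
    by (simp only: fa_mult_sum_left) (simp only: fa_mult_sum_right)
  also have "\<dots> \<approx> (\<Sum>p\<in>P. \<Sum>q\<in>Q. \<Sum>q'\<in>Q. \<Sum>t\<in>T. if q = q' then fa_smult (c p q * d q t) (A p \<odot> D t) else 0)"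
    by (intro eqv_sum term_eqv)
  also have "\<dots> = (\<Sum>p\<in>P. \<Sum>q\<in>Q. \<Sum>t\<in>T. fa_smult (c p q * d q t) (A p \<odot> D t))"
  proof (intro sum.cong refl)
    fix p q assume "q \<in> Q"
    have "(\<Sum>q'\<in>Q. \<Sum>t\<in>T. if q = q' then fa_smult (c p q * d q t) (A p \<odot> D t) else 0)
      = (\<Sum>q'\<in>Q. if q = q' then \<Sum>t\<in>T. fa_smult (c p q * d q t) (A p \<odot> D t) else 0)"
      by (intro sum.cong) auto
    then show "(\<Sum>q'\<in>Q. \<Sum>t\<in>T. if q = q' then fa_smult (c p q * d q t) (A p \<odot> D t) else 0)
      = (\<Sum>t\<in>T. fa_smult (c p q * d q t) (A p \<odot> D t))"
      using \<open>q \<in> Q\<close> \<open>finite Q\<close> by simp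
  qed
  also have "\<dots> = (\<Sum>p\<in>P. \<Sum>t\<in>T. fa_smult (matmul Q c d p t) (A p \<odot> D t))"
    unfolding matmul_def fa_smult_sum_left by (intro sum.cong refl sum.swap)
  finally show ?thesis .
qed

end

section \<open>Homogeneous elements as matrices\<close>

text \<open>In the locale below \<open>F\<close> is the finite set of edges occurring in a given homogeneous element.
  Working with the edges of \<open>F\<close> only, the element \<open>gap v\<close> measures the failure of the
  relation \<open>\<Sum> a a\<^sup>* = v\<close>; this treats regular vertices, sinks and infinite emitters alike.\<close>

locale finite_subgraph = digraph V E1 s r
  for V :: "'v set" and E1 :: "'e set" and s r :: "'e \<Rightarrow> 'v" +
  fixes F :: "'e set"
  assumes finite_V: "finite V" and finite_F: "finite F" and F_sub: "F \<subseteq> E1"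
begin

lemma F_in [simp]: "a \<in> F \<Longrightarrow> a \<in> E1" "a \<in> F \<Longrightarrow> s a \<in> V" "a \<in> F \<Longrightarrow> r a \<in> V"
  using F_sub source_in range_in by auto

definition gap :: "'v \<Rightarrow> ('v,'e) gen list \<Rightarrow> 'k::{ring,monoid_mult}" where
  "gap v = vx v - (\<Sum>a\<in>{a \<in> F. s a = v}. ed a \<odot> gh a)"

lemma gap_FA [simp]: "v \<in> V \<Longrightarrow> gap v \<in> FA V E1"
  unfolding gap_def by (intro FA_diff FA_sum FA_mult) auto

lemma gap_central: "central_coeffs (gap v)"
  unfolding gap_def
  by (intro central_coeffs_diff central_coeffs_sum central_coeffs_mult central_coeffs_mono)

text \<open>If \<open>a\<close> starts at \<open>v\<close>, the summand
  \<open>ed a \<odot> gh a\<close> of \<open>gap v\<close> reproduces \<open>ed a\<close> and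
  cancels the contribution of \<open>vx v\<close>; every other product vanishes. This needs
  \<open>a\<close> to lie in \<open>F\<close>.\<close>

lemma gap_ed:
  assumes "v \<in> V" "a \<in> F"
  shows "gap v \<odot> ed a \<approx> 0"
proof -
  let ?A = "{a \<in> F. s a = v}"
  have "gap v \<odot> ed a = vx v \<odot> ed a - (\<Sum>b\<in>?A. ed b \<odot> (gh b \<odot> ed a))"
    by (simp add: gap_def fa_mult_diff_left fa_mult_sum_left fa_mult_assoc del: minus_apply)
  also have "\<dots> \<approx> (if v = s a then ed a else 0) - (\<Sum>b\<in>?A. ed b \<odot> (if b = a then vx (r b) else 0))"
    using assms by (intro eqv_diff vx_ed eqv_sum eqv_mult_left gh_ed) auto
  also have "(\<Sum>b\<in>?A. ed b \<odot> (if b = a then vx (r b) else 0)) = (\<Sum>b\<in>?A. if b = a then ed a \<odot> vx (r a) else 0)"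
    by (intro sum.cong) auto
  also have "\<dots> = (if v = s a then ed a \<odot> vx (r a) else 0)"
    using finite_F assms by auto
  also have "(if v = s a then ed a else 0) - (if v = s a then ed a \<odot> vx (r a) else 0)
      \<approx> (if v = s a then ed a else 0) - (if v = s a then ed a else 0)"
    using assms by (intro eqv_diff) (auto intro: eqv_refl FA_zero ed_rng)
  also have "\<dots> = 0" by simp
  finally show ?thesis .
qed

lemma gh_gap:
  assumes "v \<in> V" "a \<in> F"
  shows "gh a \<odot> gap v \<approx> 0"
proof -
  let ?A = "{a \<in> F. s a = v}"
  have "gh a \<odot> gap v = gh a \<odot> vx v - (\<Sum>b\<in>?A. (gh a \<odot> ed b) \<odot> gh b)"
    by (simp add: gap_def fa_mult_diff_right fa_mult_sum_right fa_mult_assoc del: minus_apply)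
  also have "\<dots> \<approx> (if v = s a then gh a else 0) - (\<Sum>b\<in>?A. (if a = b then vx (r a) else 0) \<odot> gh b)"
    using assms by (intro eqv_diff gh_vx eqv_sum eqv_mult_right gh_ed) auto
  also have "(\<Sum>b\<in>?A. (if a = b then vx (r a) else 0) \<odot> gh b) = (\<Sum>b\<in>?A. if a = b then vx (r a) \<odot> gh a else 0)"
    by (intro sum.cong) auto
  also have "\<dots> = (if v = s a then vx (r a) \<odot> gh a else 0)"
    using finite_F assms by auto
  also have "(if v = s a then gh a else 0) - (if v = s a then vx (r a) \<odot> gh a else 0)
      \<approx> (if v = s a then gh a else 0) - (if v = s a then gh a else 0)"
    using assms by (intro eqv_diff) (auto intro: eqv_refl FA_zero rng_gh)
  also have "\<dots> = 0" by simp
  finally show ?thesis .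
qed

lemma vx_gap:
  assumes "v \<in> V"
  shows "vx v \<odot> gap v \<approx> gap v"
proof -
  have "vx v \<odot> gap v = vx v \<odot> vx v - (\<Sum>a\<in>{a \<in> F. s a = v}. (vx v \<odot> ed a) \<odot> gh a)"
    by (simp add: gap_def fa_mult_diff_right fa_mult_sum_right fa_mult_assoc del: minus_apply)
  also have "\<dots> \<approx> vx v - (\<Sum>a\<in>{a \<in> F. s a = v}. ed a \<odot> gh a)"
    using assms vx_vx[of v v] by (intro eqv_diff eqv_sum eqv_mult_right) (auto intro: src_ed)
  finally show ?thesis by (simp only: gap_def)
qed

lemma gap_vx:
  assumes "v \<in> V" "u \<in> V"
  shows "gap v \<odot> vx u \<approx> (if v = u then gap v else 0)"
proof -
  have "gap v \<odot> vx u = vx v \<odot> vx u - (\<Sum>a\<in>{a \<in> F. s a = v}. ed a \<odot> (gh a \<odot> vx u))"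
    by (simp add: gap_def fa_mult_diff_left fa_mult_sum_left fa_mult_assoc del: minus_apply)
  also have "\<dots> \<approx> (if v = u then vx v else 0) - (\<Sum>a\<in>{a \<in> F. s a = v}. ed a \<odot> (if u = s a then gh a else 0))"
    using assms by (intro eqv_diff eqv_sum eqv_mult_left vx_vx gh_vx) auto
  also have "\<dots> = (if v = u then gap v else 0)"
    by (auto simp: gap_def intro!: sum.neutral)
  finally show ?thesis .
qed

text \<open>Expanding only the second factor suffices, because its edge terms are annihilated by the
  first gap.\<close>

lemma gap_gap:
  assumes "v \<in> V" "u \<in> V"
  shows "gap v \<odot> gap u \<approx> (if v = u then gap v else 0)"
proof -
  have "gap v \<odot> gap u = gap v \<odot> vx u - (\<Sum>a\<in>{a \<in> F. s a = u}. (gap v \<odot> ed a) \<odot> gh a)"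
    unfolding gap_def[of u] by (simp add: fa_mult_diff_right fa_mult_sum_right fa_mult_assoc del: minus_apply)
  also have "\<dots> \<approx> (if v = u then gap v else 0) - (\<Sum>a\<in>{a \<in> F. s a = u}. 0 \<odot> gh a)"
    using assms by (intro eqv_diff eqv_sum eqv_mult_right gap_vx gap_ed) auto
  finally show ?thesis by (simp del: minus_apply zero_fun_apply)
qed

text \<open>\<open>k\<close> is the number of edges by which a path may still be extended. At the
  length bound the expansion stops and the whole vertex is kept; below the bound only the gap
  remains.\<close>

definition cell :: "nat \<Rightarrow> 'v \<Rightarrow> ('v,'e) gen list \<Rightarrow> 'k::{ring,monoid_mult}" where
  "cell k v = (if k = 0 then vx v else gap v)"

lemma cell_FA [simp]: "v \<in> V \<Longrightarrow> cell k v \<in> FA V E1"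
  by (simp add: cell_def)

lemma cell_central: "central_coeffs (cell k v)"
  by (simp add: cell_def gap_central central_coeffs_mono)

lemma cell_cell: "v \<in> V \<Longrightarrow> u \<in> V \<Longrightarrow> cell k v \<odot> cell k u \<approx> (if v = u then cell k v else 0)"
  using gap_gap[of v u] vx_vx[of v u] by (auto simp: cell_def)

lemma vx_cell: "v \<in> V \<Longrightarrow> vx v \<odot> cell k v \<approx> cell k v"
  using vx_gap[of v] vx_vx[of v v] by (auto simp: cell_def)

lemma cell_vx: "v \<in> V \<Longrightarrow> cell k v \<odot> vx v \<approx> cell k v"
  using gap_vx[of v v] vx_vx[of v v] by (auto simp: cell_def)

section \<open>Paths in \<open>F\<close> and their orthogonal families\<close>

primrec fpath :: "'e list \<Rightarrow> 'v \<Rightarrow> bool" where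
  "fpath [] v \<longleftrightarrow> v \<in> V"
| "fpath (a # es) v \<longleftrightarrow> a \<in> F \<and> s a = v \<and> fpath es (r a)"

primrec target :: "'e list \<Rightarrow> 'v \<Rightarrow> 'v" where
  "target [] v = v"
| "target (a # es) v = target es (r a)"

lemma fpath_source [simp]: "fpath es v \<Longrightarrow> v \<in> V"
  by (cases es) auto

lemma fpath_target [simp]: "fpath es v \<Longrightarrow> target es v \<in> V"
  by (induction es arbitrary: v) auto

lemma fpath_set: "fpath es v \<Longrightarrow> set es \<subseteq> F"
  by (induction es arbitrary: v) auto

lemma fpath_snoc: "fpath (es @ [a]) v \<longleftrightarrow> fpath es v \<and> a \<in> F \<and> s a = target es v"
  by (induction es arbitrary: v) auto

lemma target_snoc: "target (es @ [a]) v = r a"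
  by (induction es arbitrary: v) auto

text \<open>For a path \<open>p\<close> of length at most \<open>N\<close>, the element \<open>left p N\<close> is \<open>p\<close> if its length is
  \<open>N\<close> and \<open>p (gap (r p))\<close> otherwise; \<open>right p N\<close> is its adjoint. Unlike the paths themselves,
  these elements are orthogonal even if one path is a prefix of another.\<close>

primrec left :: "'e list \<Rightarrow> nat \<Rightarrow> 'v \<Rightarrow> ('v,'e) gen list \<Rightarrow> 'k::{ring,monoid_mult}" where
  "left [] N v = cell N v"
| "left (a # es) N v = ed a \<odot> left es (N - 1) (r a)"

primrec right :: "'e list \<Rightarrow> nat \<Rightarrow> 'v \<Rightarrow> ('v,'e) gen list \<Rightarrow> 'k::{ring,monoid_mult}" where
  "right [] N v = cell N v"
| "right (a # es) N v = right es (N - 1) (r a) \<odot> gh a"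

lemma left_FA [simp]: "fpath es v \<Longrightarrow> left es N v \<in> FA V E1"
  by (induction es arbitrary: N v) (auto intro!: FA_mult)

lemma right_FA [simp]: "fpath es v \<Longrightarrow> right es N v \<in> FA V E1"
  by (induction es arbitrary: N v) (auto intro!: FA_mult)

lemma left_central: "central_coeffs (left es N v)"
  by (induction es arbitrary: N v) (auto intro!: central_coeffs_mult central_coeffs_mono cell_central)

lemma right_central: "central_coeffs (right es N v)"
  by (induction es arbitrary: N v) (auto intro!: central_coeffs_mult central_coeffs_mono cell_central)

lemma vx_left: "fpath es v \<Longrightarrow> vx v \<odot> left es N v \<approx> left es N v"
proof (cases es)
  case (Cons a es')
  assume "fpath es v"
  then show ?thesis
    using Cons eqv_mult_right[OF left_FA src_ed[of a], of es' "r a"] by (auto simp: fa_mult_assoc)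
qed (auto simp: vx_cell)

text \<open>The recursion ends in the idempotent \<open>cell (N - length es) (target es v)\<close>,
  which can therefore be repeated. This and \<open>target_right\<close> provide the absorption
  required by \<open>matrix_product_eqv\<close>.\<close>

lemma left_target:
  "fpath es v \<Longrightarrow> left es N v \<odot> cell (N - length es) (target es v) \<approx> left es N v"
proof (induction es arbitrary: N v)
  case Nil
  then show ?case using cell_cell[of v v N] by auto
next
  case (Cons a es)
  then show ?case
    using eqv_mult_left[OF gen_FA(2) Cons.IH[of "r a" "N - 1"], of a] by (auto simp: fa_mult_assoc)
qed

lemma target_right:
  "fpath es v \<Longrightarrow> cell (N - length es) (target es v) \<odot> right es N v \<approx> right es N v"
proof (induction es arbitrary: N v)
  case Nil
  then show ?case using cell_cell[of v v N] by auto
next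
  case (Cons a es)
  then show ?case
    using eqv_mult_right[OF gen_FA(3) Cons.IH[of "r a" "N - 1"], of a] by (auto simp: fa_mult_assoc)
qed

lemma cell_ed: "a \<in> F \<Longrightarrow> v \<in> V \<Longrightarrow> k \<noteq> 0 \<Longrightarrow> cell k v \<odot> ed a \<approx> 0"
  by (simp add: cell_def gap_ed)

lemma gh_cell: "a \<in> F \<Longrightarrow> v \<in> V \<Longrightarrow> k \<noteq> 0 \<Longrightarrow> gh a \<odot> cell k v \<approx> 0"
  by (simp add: cell_def gh_gap)

text \<open>Common initial edges cancel, and the first differing pair of edges gives zero. If one
  path ends before the other, the length bounds force its cell to have positive index; the cell is
  then a gap and kills the next edge. If both end together, the product of their cells
  remains.\<close>

lemma right_left:
  assumes "fpath es v" "fpath es' v'" "length es \<le> N" "length es' \<le> N"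
  shows "right es N v \<odot> left es' N v' \<approx>
    (if (v, es) = (v', es') then cell (N - length es) (target es v)
     else (0 :: _ \<Rightarrow> 'k::{ring,monoid_mult}))"
  using assms
proof (induction es arbitrary: N v v' es')
  case Nil
  show ?case
  proof (cases es')
    case Nil
    then show ?thesis using Nil.prems cell_cell[of v v' N] by auto
  next
    case (Cons a fs)
    have "(cell N v \<odot> ed a) \<odot> left fs (N - 1) (r a) \<approx> 0 \<odot> left fs (N - 1) (r a)"
      using Nil.prems Cons by (intro eqv_mult_right cell_ed) auto
    then show ?thesis using Cons by (simp add: fa_mult_assoc del: zero_fun_apply)
  qed
next
  case (Cons a es)
  show ?case
  proof (cases es')
    case Nil
    have "right es (N - 1) (r a) \<odot> (gh a \<odot> cell N v') \<approx> right es (N - 1) (r a) \<odot> 0"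
      using Cons.prems Nil by (intro eqv_mult_left gh_cell) auto
    then show ?thesis using Nil by (simp add: fa_mult_assoc del: zero_fun_apply)
  next
    case es': (Cons b fs)
    let ?R = "right es (N - 1) (r a) :: _ \<Rightarrow> 'k" and ?L = "left fs (N - 1) (r b) :: _ \<Rightarrow> 'k"
    have FA: "?R \<in> FA V E1" "?L \<in> FA V E1" using Cons.prems es' by auto
    have "right (a # es) N v \<odot> left es' N v' = ?R \<odot> ((gh a \<odot> ed b) \<odot> ?L)"
      using es' by (simp add: fa_mult_assoc)
    also have "\<dots> \<approx> ?R \<odot> ((if a = b then vx (r a) else 0) \<odot> ?L)"
      using Cons.prems es' FA by (intro eqv_mult_left eqv_mult_right gh_ed) auto
    also have "\<dots> \<approx> (if (v, a # es) = (v', es') then cell (N - length (a # es)) (target (a # es) v) else 0)"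
    proof (cases "a = b")
      case True
      have "?R \<odot> (vx (r a) \<odot> ?L) \<approx> ?R \<odot> ?L"
        using Cons.prems es' FA True by (intro eqv_mult_left) (auto intro: vx_left)
      also have "\<dots> \<approx> (if (r a, es) = (r b, fs) then cell (N - 1 - length es) (target es (r a)) else 0)"
        using Cons.prems es' by (intro Cons.IH) auto
      finally show ?thesis using True es' Cons.prems by (auto split: if_splits)
    next
      case False
      then show ?thesis using es' by (simp add: eqv_refl FA_zero del: zero_fun_apply)
    qed
    finally show ?thesis .
  qed
qed

section \<open>Expansion of path monomials\<close>

abbreviation "pw v es \<equiv> fa_mono (path_word (v, es))"
abbreviation "gw v es \<equiv> fa_mono (ghost_word (v, es))"

lemma pw_FA [simp]: "fpath es v \<Longrightarrow> pw v es \<in> FA V E1"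
  by (auto intro!: FA_mono imageI F_in(1) simp: path_word_def gens_def dest: subsetD[OF fpath_set])

lemma gw_FA [simp]: "fpath es v \<Longrightarrow> gw v es \<in> FA V E1"
  by (auto intro!: FA_mono imageI F_in(1) simp: ghost_word_def gens_def dest: subsetD[OF fpath_set])

text \<open>Only a congruence: for empty \<open>es\<close> the right side carries the additional
  letter \<open>Vx (r a)\<close>.\<close>

lemma pw_Cons: "fpath (a # es) v \<Longrightarrow> pw v (a # es) \<approx> ed a \<odot> pw (r a) es"
  using eqv_sym[OF ed_rng, of a] eqv_refl[OF pw_FA, of "a # es" v]
  by (cases es) (auto simp: path_word_def fa_mono_mult)

lemma gw_Cons: "fpath (a # es) v \<Longrightarrow> gw v (a # es) \<approx> gw (r a) es \<odot> gh a"
  using eqv_sym[OF rng_gh, of a] eqv_refl[OF gw_FA, of "a # es" v]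
  by (cases es) (auto simp: ghost_word_def fa_mono_mult)

lemma pw_snoc: "fpath (es @ [a]) v \<Longrightarrow> pw v es \<odot> ed a \<approx> pw v (es @ [a])"
  using src_ed[of a] eqv_refl[OF pw_FA, of "es @ [a]" v]
  by (cases es) (auto simp: path_word_def fa_mono_mult)

lemma gw_snoc: "fpath (es @ [a]) v \<Longrightarrow> gh a \<odot> gw v es \<approx> gw v (es @ [a])"
  using gh_src[of a] eqv_refl[OF gw_FA, of "es @ [a]" v]
  by (cases es) (auto simp: ghost_word_def fa_mono_mult)

lemma pw_cell:
  "fpath es v \<Longrightarrow> pw v es \<odot> cell (N - length es) (target es v) \<approx> left es N v"
proof (induction es arbitrary: N v)
  case Nil
  then show ?case using vx_cell by (simp add: path_word_def)
next
  case (Cons a es)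
  let ?c = "cell (N - length (a # es)) (target (a # es) v) :: _ \<Rightarrow> 'a"
  have "pw v (a # es) \<odot> ?c \<approx> (ed a \<odot> pw (r a) es) \<odot> ?c"
    by (rule eqv_mult_right[OF cell_FA[OF fpath_target[OF Cons.prems]] pw_Cons[OF Cons.prems]])
  also have "\<dots> = ed a \<odot> (pw (r a) es \<odot> cell (N - 1 - length es) (target es (r a)))"
    by (simp add: fa_mult_assoc)
  also have "\<dots> \<approx> ed a \<odot> left es (N - 1) (r a)"
    using Cons.prems by (intro eqv_mult_left Cons.IH) auto
  finally show ?case by simp
qed

lemma cell_gw:
  "fpath es v \<Longrightarrow> cell (N - length es) (target es v) \<odot> gw v es \<approx> right es N v"
proof (induction es arbitrary: N v)
  case Nil
  then show ?case using cell_vx by (simp add: ghost_word_def)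
next
  case (Cons a es)
  let ?c = "cell (N - length (a # es)) (target (a # es) v) :: _ \<Rightarrow> 'a"
  have "?c \<odot> gw v (a # es) \<approx> ?c \<odot> (gw (r a) es \<odot> gh a)"
    by (rule eqv_mult_left[OF cell_FA[OF fpath_target[OF Cons.prems]] gw_Cons[OF Cons.prems]])
  also have "\<dots> = (cell (N - 1 - length es) (target es (r a)) \<odot> gw (r a) es) \<odot> gh a"
    by (simp add: fa_mult_assoc)
  also have "\<dots> \<approx> right es (N - 1) (r a) \<odot> gh a"
    using Cons.prems by (intro eqv_mult_right Cons.IH) auto
  finally show ?case by simp
qed

lemma pw_target: "fpath es v \<Longrightarrow> pw v es \<odot> vx (target es v) \<approx> pw v es"
proof (induction es arbitrary: v)
  case Nil
  then show ?case using vx_vx[of v v] by (simp add: path_word_def)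
next
  case (Cons a es)
  let ?c = "vx (target es (r a)) :: _ \<Rightarrow> 'a"
  have c: "?c \<in> FA V E1" using Cons.prems by auto
  have "pw v (a # es) \<odot> ?c \<approx> (ed a \<odot> pw (r a) es) \<odot> ?c"
    using c pw_Cons[OF Cons.prems] by (rule eqv_mult_right)
  also have "\<dots> \<approx> ed a \<odot> pw (r a) es"
    unfolding fa_mult_assoc using Cons.prems by (intro eqv_mult_left Cons.IH) auto
  also have "\<dots> \<approx> pw v (a # es)"
    using Cons.prems by (rule eqv_sym[OF pw_Cons])
  finally show ?case by simp
qed

section \<open>Matrices indexed by paths of bounded length\<close>

definition paths_upto :: "nat \<Rightarrow> ('v \<times> 'e list) set" where
  "paths_upto N = {(v, es). fpath es v \<and> length es \<le> N}"

lemma finite_paths_upto: "finite (paths_upto N)"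
proof (rule finite_subset)
  show "paths_upto N \<subseteq> V \<times> {es. set es \<subseteq> F \<and> length es \<le> N}"
    by (auto simp: paths_upto_def dest: fpath_set)
  show "finite (V \<times> {es. set es \<subseteq> F \<and> length es \<le> N})"
    using finite_V finite_F finite_lists_length_le by blast
qed

abbreviation "lft N p \<equiv> left (snd p) N (fst p)"
abbreviation "rgt N p \<equiv> right (snd p) N (fst p)"

abbreviation lincomb :: "nat \<Rightarrow> nat \<Rightarrow> ('v \<times> 'e list \<Rightarrow> 'v \<times> 'e list \<Rightarrow> 'k::{ring,monoid_mult})
    \<Rightarrow> ('v,'e) gen list \<Rightarrow> 'k" where
  "lincomb N M c \<equiv>
    (\<Sum>p\<in>paths_upto N. \<Sum>q\<in>paths_upto M. fa_smult (c p q) (lft N p \<odot> rgt M q))"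

text \<open>Under this condition the cell at the end of \<open>lft N p\<close> is the same as the
  one at the start of \<open>rgt M q\<close>.\<close>

definition matching :: "nat \<Rightarrow> nat \<Rightarrow> ('v \<times> 'e list) \<Rightarrow> ('v \<times> 'e list) \<Rightarrow> bool" where
  "matching N M p q \<longleftrightarrow> N - length (snd p) = M - length (snd q) \<and>
     target (snd p) (fst p) = target (snd q) (fst q)"

definition in_span :: "nat \<Rightarrow> nat \<Rightarrow> (('v,'e) gen list \<Rightarrow> 'k::{ring,monoid_mult}) \<Rightarrow> bool" where
  "in_span N M x \<longleftrightarrow> (\<exists>c. (\<forall>p q. c p q \<noteq> 0 \<longrightarrow> matching N M p q) \<and> x \<approx> lincomb N M c)"

lemma in_span_eqv: "x \<approx> y \<Longrightarrow> in_span N M y \<Longrightarrow> in_span N M x"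
  unfolding in_span_def using eqv_trans by blast

lemma in_span_zero: "in_span N M 0"
  unfolding in_span_def
  by (rule exI[of _ "\<lambda>p q. 0"]) (simp add: fa_smult_simps eqv_refl FA_zero del: zero_fun_apply)

lemma in_span_add:
  assumes "in_span N M x" "in_span N M y"
  shows "in_span N M (x + y)"
proof -
  obtain c d where c: "\<forall>p q. c p q \<noteq> 0 \<longrightarrow> matching N M p q" "x \<approx> lincomb N M c"
    and d: "\<forall>p q. d p q \<noteq> 0 \<longrightarrow> matching N M p q" "y \<approx> lincomb N M d"
    using assms unfolding in_span_def by blast
  have "lincomb N M c + lincomb N M d = lincomb N M (\<lambda>p q. c p q + d p q)"
    by (simp add: fa_smult_simps sum.distrib del: plus_fun_apply)
  then show ?thesis
    unfolding in_span_def using eqv_add[OF c(2) d(2)] c(1) d(1)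
    by (intro exI[of _ "\<lambda>p q. c p q + d p q"]) (metis add.right_neutral)
qed

lemma in_span_smult:
  assumes "in_span N M x"
  shows "in_span N M (fa_smult k x)"
proof -
  obtain c where c: "\<forall>p q. c p q \<noteq> 0 \<longrightarrow> matching N M p q" "x \<approx> lincomb N M c"
    using assms unfolding in_span_def by blast
  have "fa_smult k (lincomb N M c) = lincomb N M (\<lambda>p q. k * c p q)"
    by (simp add: fa_smult_simps fa_smult_sum_right)
  then show ?thesis
    unfolding in_span_def using eqv_smult[OF c(2), of k] c(1)
    by (intro exI[of _ "\<lambda>p q. k * c p q"]) (metis mult_zero_right)
qed

lemma in_span_sum: "(\<And>i. i \<in> A \<Longrightarrow> in_span N M (f i)) \<Longrightarrow> in_span N M (\<Sum>i\<in>A. f i)"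
  by (induction A rule: infinite_finite_induct)
    (simp_all add: in_span_zero in_span_add del: plus_fun_apply zero_fun_apply)

lemma in_span_left_right:
  assumes "p \<in> paths_upto N" "q \<in> paths_upto M" "matching N M p q"
  shows "in_span N M (lft N p \<odot> rgt M q :: _ \<Rightarrow> 'k::{ring,monoid_mult})"
proof -
  define c :: "_ \<Rightarrow> _ \<Rightarrow> 'k" where "c = (\<lambda>p' q'. if p' = p then if q' = q then 1 else 0 else 0)"
  have "lincomb N M c = (\<Sum>p'\<in>paths_upto N. if p' = p then
      (\<Sum>q'\<in>paths_upto M. if q' = q then lft N p \<odot> rgt M q else 0) else 0)"
    by (auto simp: c_def fa_smult_simps intro!: sum.cong sum.neutral simp del: zero_fun_apply)
  also have "\<dots> = lft N p \<odot> rgt M q"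
    using assms finite_paths_upto by simp
  finally have "lft N p \<odot> rgt M q \<approx> lincomb N M c"
    using assms by (auto simp: paths_upto_def intro!: eqv_refl FA_mult)
  then show ?thesis
    unfolding in_span_def using assms(3) by (intro exI[of _ c]) (auto simp: c_def)
qed

text \<open>\<open>k\<close> counts the edges still to be appended to both paths, which keeps the
  difference of their lengths fixed. Inserting \<open>v = gap v + \<Sum> a a*\<close> at the common
  target splits off a product of \<open>left\<close> and \<open>right\<close> and leaves monomials
  with both paths longer by one edge.\<close>

lemma monomial_in_span:
  assumes "fpath es v" "fpath es' v'" "target es v = target es' v'"
    and "length es + k = N" "length es' + k = M"
  shows "in_span N M (pw v es \<odot> gw v' es' :: _ \<Rightarrow> 'k::{ring,monoid_mult})"
  using assms
proof (induction k arbitrary: es es')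
  case (0 es es')
  let ?u = "target es v"
  have u: "?u \<in> V" using 0 by auto
  have "pw v es \<odot> gw v' es' \<approx> (pw v es \<odot> vx ?u) \<odot> gw v' es'"
    using 0 by (intro eqv_mult_right eqv_sym[OF pw_target]) auto
  \<comment> \<open>The idempotent is doubled because \<open>left\<close> and \<open>right\<close>
    each take their own copy of the cell, which is the vertex itself at full length.\<close>
  also have "\<dots> \<approx> (pw v es \<odot> (vx ?u \<odot> vx ?u)) \<odot> gw v' es'"
    using 0 u vx_vx[of ?u ?u] by (intro eqv_mult_right eqv_mult_left) (auto intro: eqv_sym)
  also have "\<dots> = (pw v es \<odot> cell (N - length es) ?u) \<odot> (cell (M - length es') (target es' v') \<odot> gw v' es')"
    using 0 by (simp add: fa_mult_assoc cell_def)
  also have "\<dots> \<approx> left es N v \<odot> right es' M v'"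
    using 0 by (intro eqv_mult pw_cell cell_gw)
  finally show ?case
    using in_span_left_right[of "(v, es)" N "(v', es')" M] 0
    by (auto simp: paths_upto_def matching_def intro: in_span_eqv)
next
  case (Suc k es es')
  let ?u = "target es v"
  let ?A = "{a \<in> F. s a = ?u}"
  have u: "?u \<in> V" using Suc.prems by auto
  have FA: "pw v es \<in> FA V E1" "gw v' es' \<in> FA V E1" using Suc.prems by auto
  have "pw v es \<odot> gw v' es' \<approx> (pw v es \<odot> vx ?u) \<odot> gw v' es'"
    using Suc.prems by (intro eqv_mult_right eqv_sym[OF pw_target]) auto
  also have "\<dots> = (pw v es \<odot> (gap ?u + (\<Sum>a\<in>?A. ed a \<odot> gh a))) \<odot> gw v' es'"
    by (simp add: gap_def del: plus_fun_apply minus_apply)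
  also have "\<dots> = pw v es \<odot> (gap ?u \<odot> gw v' es') + (\<Sum>a\<in>?A. (pw v es \<odot> ed a) \<odot> (gh a \<odot> gw v' es'))"
    by (simp add: fa_mult_add_left fa_mult_add_right fa_mult_sum_left fa_mult_sum_right fa_mult_assoc
        del: plus_fun_apply)
  \<comment> \<open>Doubling the gap serves the same purpose below full length, where the cell is
    the gap.\<close>
  also have "\<dots> \<approx> pw v es \<odot> ((gap ?u \<odot> gap ?u) \<odot> gw v' es')
      + (\<Sum>a\<in>?A. pw v (es @ [a]) \<odot> gw v' (es' @ [a]))"
    using Suc.prems FA u gap_gap[OF u u]
    by (intro eqv_add eqv_sum eqv_mult pw_snoc gw_snoc)
      (auto intro: eqv_refl eqv_sym simp: fpath_snoc)
  finally have 1: "pw v es \<odot> gw v' es' \<approx> pw v es \<odot> ((gap ?u \<odot> gap ?u) \<odot> gw v' es')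
      + (\<Sum>a\<in>?A. pw v (es @ [a]) \<odot> gw v' (es' @ [a]) :: _ \<Rightarrow> 'k)" .
  have "pw v es \<odot> ((gap ?u \<odot> gap ?u) \<odot> gw v' es')
     = (pw v es \<odot> cell (N - length es) ?u) \<odot> (cell (M - length es') (target es' v') \<odot> gw v' es')"
    using Suc.prems by (auto simp: fa_mult_assoc cell_def)
  also have "\<dots> \<approx> left es N v \<odot> right es' M v'"
    using Suc.prems by (intro eqv_mult pw_cell cell_gw)
  finally have "in_span N M (pw v es \<odot> ((gap ?u \<odot> gap ?u) \<odot> gw v' es') :: _ \<Rightarrow> 'k)"
    using in_span_left_right[of "(v, es)" N "(v', es')" M] Suc.prems
    by (auto simp: paths_upto_def matching_def intro: in_span_eqv)
  moreover have "in_span N M (\<Sum>a\<in>?A. pw v (es @ [a]) \<odot> gw v' (es' @ [a]) :: _ \<Rightarrow> 'k)"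
    using Suc.prems by (intro in_span_sum Suc.IH) (auto simp: fpath_snoc target_snoc)
  ultimately show ?case
    by (intro in_span_eqv[OF 1] in_span_add)
qed

text \<open>An inner inverse \<open>d\<close> of the coefficient matrix, with the roles of
  \<open>N\<close> and \<open>M\<close> exchanged, gives \<open>y\<close>. The support of
  \<open>d\<close> is not controlled, so the local units are absorbed on the side of
  \<open>c\<close>: by \<open>lft\<close> in the product \<open>c d\<close> and by
  \<open>rgt\<close> in the product \<open>(c d) c\<close>.\<close>

lemma in_span_regular:
  fixes x :: "('v,'e) gen list \<Rightarrow> 'k::{ring,monoid_mult}"
  assumes "von_neumann_regular TYPE('k)" "in_span N M x"
  shows "\<exists>y\<in>FA V E1. x \<odot> y \<odot> x \<approx> x"
proof -
  let ?P = "paths_upto N" and ?Q = "paths_upto M"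
  obtain c where c: "\<And>p q. c p q \<noteq> 0 \<Longrightarrow> matching N M p q" and x: "x \<approx> lincomb N M c"
    using assms(2) unfolding in_span_def by blast
  obtain d where d: "\<And>p q. p \<in> ?P \<Longrightarrow> q \<in> ?Q \<Longrightarrow> matmul ?P (matmul ?Q c d) c p q = c p q"
    using vnr_matrix[OF assms(1) finite_paths_upto finite_paths_upto] by metis
  let ?y = "lincomb M N d"
  have y: "?y \<in> FA V E1"
    by (intro FA_sum FA_smult FA_mult) (auto simp: paths_upto_def)
  have xy: "lincomb N M c \<odot> ?y \<approx> lincomb N N (matmul ?Q c d)"
  proof (rule matrix_product_eqv[OF finite_paths_upto, where g = "\<lambda>q. cell (M - length (snd q)) (target (snd q) (fst q))"])
    fix q q' assume "q \<in> ?Q" "q' \<in> ?Q"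
    then show "rgt M q \<odot> lft M q' \<approx>
        (if q = q' then cell (M - length (snd q)) (target (snd q) (fst q)) else (0 :: _ \<Rightarrow> 'k))"
      using right_left[of "snd q" "fst q" "snd q'" "fst q'" M] by (simp add: paths_upto_def split_def)
  next
    fix p q t assume *: "p \<in> ?P" "q \<in> ?Q" "t \<in> ?P" "c p q \<noteq> 0"
    then have "lft N p \<odot> cell (M - length (snd q)) (target (snd q) (fst q)) \<approx> (lft N p :: _ \<Rightarrow> 'k)"
      using left_target[of "snd p" "fst p" N] c[OF *(4)] by (auto simp: paths_upto_def matching_def)
    then show "lft N p \<odot> (cell (M - length (snd q)) (target (snd q) (fst q)) \<odot> rgt N t)
        \<approx> (lft N p \<odot> rgt N t :: _ \<Rightarrow> 'k)"
      unfolding fa_mult_assoc[symmetric] using * by (intro eqv_mult_right) (auto simp: paths_upto_def)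
  qed (auto simp: paths_upto_def left_central right_central)
  have xyx: "lincomb N N (matmul ?Q c d) \<odot> lincomb N M c \<approx> lincomb N M (matmul ?P (matmul ?Q c d) c)"
  proof (rule matrix_product_eqv[OF finite_paths_upto, where g = "\<lambda>q. cell (N - length (snd q)) (target (snd q) (fst q))"])
    fix q q' assume "q \<in> ?P" "q' \<in> ?P"
    then show "rgt N q \<odot> lft N q' \<approx>
        (if q = q' then cell (N - length (snd q)) (target (snd q) (fst q)) else (0 :: _ \<Rightarrow> 'k))"
      using right_left[of "snd q" "fst q" "snd q'" "fst q'" N] by (simp add: paths_upto_def split_def)
  next
    fix p q t assume *: "p \<in> ?P" "q \<in> ?P" "t \<in> ?Q" "c q t \<noteq> 0"
    then have "cell (N - length (snd q)) (target (snd q) (fst q)) \<odot> rgt M t \<approx> (rgt M t :: _ \<Rightarrow> 'k)"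
      using target_right[of "snd t" "fst t" M] c[OF *(4)] by (auto simp: paths_upto_def matching_def)
    then show "lft N p \<odot> (cell (N - length (snd q)) (target (snd q) (fst q)) \<odot> rgt M t)
        \<approx> (lft N p \<odot> rgt M t :: _ \<Rightarrow> 'k)"
      using * by (intro eqv_mult_left) (auto simp: paths_upto_def)
  qed (auto simp: paths_upto_def left_central right_central)
  have "x \<odot> ?y \<odot> x \<approx> lincomb N M c \<odot> ?y \<odot> lincomb N M c"
    using x y by (intro eqv_mult eqv_refl)
  also have "\<dots> \<approx> lincomb N N (matmul ?Q c d) \<odot> lincomb N M c"
    using xy eqv_FA(2)[OF x] by (intro eqv_mult_right)
  also note xyx
  also have "lincomb N M (matmul ?P (matmul ?Q c d) c) = lincomb N M c"
    using d by (intro sum.cong refl) auto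
  also have "lincomb N M c \<approx> x" using x by (rule eqv_sym)
  finally show ?thesis using y by blast
qed

end

section \<open>Homogeneous elements are regular\<close>

lemma (in digraph) is_path_Cons:
  assumes "is_path V E1 s r (v, a # es)"
  shows "a \<in> E1" "s a = v" "is_path V E1 s r (r a, es)"
proof -
  have *: "a \<in> E1" "set es \<subseteq> E1" "s a = v"
    and succ: "\<And>i. Suc i < length (a # es) \<Longrightarrow> r ((a # es) ! i) = s ((a # es) ! Suc i)"
    using assms by (auto simp: is_path_def)
  show "a \<in> E1" "s a = v" by fact+
  have "s (hd es) = r a" if "es \<noteq> []"
    using succ[of 0] that by (simp add: hd_conv_nth)
  moreover have "r (es ! i) = s (es ! Suc i)" if "Suc i < length es" for i
    using succ[of "Suc i"] that by simp
  ultimately show "is_path V E1 s r (r a, es)"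
    using * range_in by (simp add: is_path_def)
qed

lemma (in finite_subgraph) is_path_fpath:
  "is_path V E1 s r (v, es) \<Longrightarrow> set es \<subseteq> F \<Longrightarrow> fpath es v"
proof (induction es arbitrary: v)
  case Nil
  then show ?case by (simp add: is_path_def)
next
  case (Cons a es)
  then show ?case using is_path_Cons[of v a es] by simp
qed

lemma (in finite_subgraph) path_r_target: "path_r r (v, es) = target es v"
proof (cases es rule: rev_cases)
  case (snoc fs a)
  then show ?thesis by (simp add: path_r_def target_snoc)
qed (simp add: path_r_def)

section \<open>Weights and lengths of paths\<close>

lemma smul_SomeD:
  "smul x y = Some (i, k, j) \<Longrightarrow> \<exists>a b m. x = Some (i, a, m) \<and> y = Some (m, b, j) \<and> k = a + b"
  by (cases x; cases y) (auto split: if_splits)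

lemma sinv_SomeD: "sinv x = Some (i, k, j) \<Longrightarrow> x = Some (j, - k, i)"
  by (cases x) auto

lemma foldl_smul_degree:
  assumes "\<forall>e\<in>set es. \<exists>i j. f e = Some (i, 1, j)" "foldl smul x (map f es) = Some (i, k, j)"
  shows "\<exists>i' k' j'. x = Some (i', k', j') \<and> k = k' + int (length es)"
  using assms
proof (induction es arbitrary: x)
  case (Cons e es)
  then obtain i' k' j' where "smul x (f e) = Some (i', k', j')" "k = k' + int (length es)"
    by fastforce
  moreover obtain i1 j1 where "f e = Some (i1, 1, j1)" using Cons.prems by auto
  ultimately show ?case by (auto dest!: smul_SomeD)
qed simp

lemma path_weight_degree:
  assumes "canonical_weight V E1 s r w" "is_path V E1 s r (v, es)"
    and "path_weight w (v, es) = Some (i, k, j)"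
  shows "k = int (length es)"
proof (cases es)
  case Nil
  then show ?thesis using assms by (auto simp: canonical_weight_def path_weight_def is_path_def)
next
  case (Cons e es')
  have "\<forall>e\<in>set es. \<exists>i j. w (Ed e) = Some (i, 1, j)"
    using assms(1,2) by (auto simp: canonical_weight_def is_path_def)
  then show ?thesis
    using Cons assms(3) foldl_smul_degree[of es' "\<lambda>e. w (Ed e)" "w (Ed e)" i k j]
    by (fastforce simp: path_weight_def)
qed

text \<open>Edges have integer coordinate 1 and inversion changes the sign. Hence all monomials of
  one nonzero weight share the same length difference, which is how homogeneity enters the
  argument.\<close>

lemma mon_weight_degree:
  assumes "canonical_weight V E1 s r w" "is_path V E1 s r (v, es)" "is_path V E1 s r (v', es')"
    and "mon_weight w (v, es) (v', es') = Some (i, k, j)"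
  shows "k = int (length es) - int (length es')"
proof -
  obtain a b m where "path_weight w (v, es) = Some (i, a, m)"
    "path_weight w (v', es') = Some (j, - b, m)" "k = a + b"
    using smul_SomeD[OF assms(4)[unfolded mon_weight_def]] sinv_SomeD by metis
  then show ?thesis
    using path_weight_degree[OF assms(1,2)] path_weight_degree[OF assms(1,3)] by force
qed

text \<open>The edge set and the length bound have to be uniform in all monomials, so the induction
  carries a statement for all sufficiently large ones.\<close>

lemma (in digraph) weight_span_in_span:
  assumes "finite V" "canonical_weight V E1 s r w" "x \<in> weight_span V E1 s r w (Some (i, k, j))"
  shows "\<exists>F\<^sub>0 K\<^sub>0. finite F\<^sub>0 \<and> F\<^sub>0 \<subseteq> E1 \<and> (\<forall>F K. finite F \<longrightarrow> F\<^sub>0 \<subseteq> F \<longrightarrow> F \<subseteq> E1 \<longrightarrow> K\<^sub>0 \<le> K \<longrightarrow>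
    finite_subgraph.in_span V E1 s r F (nat k + K) (nat (- k) + K) x)"
  using assms(3)
proof induction
  case zero
  have "finite_subgraph.in_span V E1 s r F N M 0" if "finite F" "F \<subseteq> E1" for F N M
  proof -
    interpret finite_subgraph V E1 s r F
      using that assms(1) by unfold_locales
    show ?thesis by (rule in_span_zero)
  qed
  then show ?case by (intro exI[of _ "{}"] exI[of _ 0]) (auto simp del: zero_fun_apply)
next
  case (step y \<mu> \<eta> c)
  obtain v es where \<mu>: "\<mu> = (v, es)" by fastforce
  obtain v' es' where \<eta>: "\<eta> = (v', es')" by fastforce
  obtain F\<^sub>0 K\<^sub>0 where F\<^sub>0: "finite F\<^sub>0" "F\<^sub>0 \<subseteq> E1"
    and y: "\<And>F K. finite F \<Longrightarrow> F\<^sub>0 \<subseteq> F \<Longrightarrow> F \<subseteq> E1 \<Longrightarrow> K\<^sub>0 \<le> K \<Longrightarrow>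
      finite_subgraph.in_span V E1 s r F (nat k + K) (nat (- k) + K) y"
    using step.IH by blast
  have len: "k = int (length es) - int (length es')"
    using mon_weight_degree[OF assms(2)] step.hyps \<mu> \<eta> by blast
  have sub: "set es \<union> set es' \<subseteq> E1" using step.hyps \<mu> \<eta> by (auto simp: is_path_def)
  have "finite_subgraph.in_span V E1 s r F (nat k + K) (nat (- k) + K)
      (y + fa_smult c (fa_mono (path_word \<mu> @ ghost_word \<eta>)))"
    if F: "finite F" "F\<^sub>0 \<union> (set es \<union> set es') \<subseteq> F" "F \<subseteq> E1"
      and K: "K\<^sub>0 + length es + length es' \<le> K" for F K
  proof -
    interpret finite_subgraph V E1 s r F
      using F assms(1) by unfold_locales
    \<comment> \<open>\<open>?N\<close> and \<open>?M\<close> differ by the degree \<open>k\<close>,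
      just as the two path lengths do, so the same number of edges brings both paths to their
      bounds. Taking \<open>K\<close> large makes this number nonnegative.\<close>
    let ?N = "nat k + K" and ?M = "nat (- k) + K"
    have "in_span ?N ?M (pw v es \<odot> gw v' es' :: _ \<Rightarrow> 'b)"
    proof (rule monomial_in_span[where k = "?N - length es"])
      show "fpath es v" "fpath es' v'" using step.hyps \<mu> \<eta> F by (auto intro: is_path_fpath)
      show "target es v = target es' v'" using step.hyps \<mu> \<eta> by (simp add: path_r_target)
      show "length es + (?N - length es) = ?N" using K by simp
      show "length es' + (?N - length es) = ?M" using K len by linarith
    qed
    then have "in_span ?N ?M (fa_smult c (fa_mono (path_word \<mu> @ ghost_word \<eta>)))"
      unfolding \<mu> \<eta> fa_mono_mult by (rule in_span_smult)
    moreover have "in_span ?N ?M y" using y F K by simp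
    ultimately show ?thesis by (intro in_span_add)
  qed
  then show ?case
    using F\<^sub>0 sub
    by (intro exI[of _ "F\<^sub>0 \<union> (set es \<union> set es')"] exI[of _ "K\<^sub>0 + length es + length es'"])
      (auto simp del: plus_fun_apply)
qed

lemma (in digraph) weight_span_regular:
  fixes x :: "('v,'e) gen list \<Rightarrow> 'k::{ring,monoid_mult}"
  assumes "von_neumann_regular TYPE('k)" "finite V" "canonical_weight V E1 s r w"
    and "x \<in> weight_span V E1 s r w (Some (i, k, j))"
  shows "\<exists>y\<in>FA V E1. x \<odot> y \<odot> x \<approx> x"
proof -
  obtain F K where F: "finite F" "F \<subseteq> E1"
    and x: "finite_subgraph.in_span V E1 s r F (nat k + K) (nat (- k) + K) x"
    using weight_span_in_span[OF assms(2-4)] by blast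
  interpret finite_subgraph V E1 s r F
    using F assms(2) by unfold_locales
  show ?thesis using in_span_regular[OF assms(1) x] .
qed

theorem theorem5p12:
  fixes V :: "'v set" and E1 :: "'e set" and s r :: "'e \<Rightarrow> 'v"
    and w :: "('v,'e) gen \<Rightarrow> 'i semi"
  assumes "finite V" and "V \<noteq> {}"
    and "\<forall>a\<in>E1. s a \<in> V \<and> r a \<in> V"
    and "canonical_weight V E1 s r w"
  shows "lpa_graded_vnr V E1 s r w TYPE('r::{ring,monoid_mult})
           \<longleftrightarrow> von_neumann_regular TYPE('r)"
proof
  interpret digraph V E1 s r
    using assms(3) by unfold_locales auto
  show "von_neumann_regular TYPE('r)" if reg: "lpa_graded_vnr V E1 s r w TYPE('r)"
    unfolding von_neumann_regular_def
  proof
    fix a :: 'r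
    obtain v where v: "v \<in> V" using assms(2) by blast
    let ?x = "fa_smult a (fa_mono [Vx v])"
    obtain i where i: "w (Vx v) = Some (i, 0, i)"
      using assms(4) v by (auto simp: canonical_weight_def)
    have p: "is_path V E1 s r (v, [])" using v by (simp add: is_path_def)
    have "mon_weight w (v, []) (v, []) = Some (i, 0, i)"
      using i by (simp add: mon_weight_def path_weight_def)
    then have "0 + fa_smult a (fa_mono (path_word (v, []) @ ghost_word (v, [])))
        \<in> weight_span V E1 s r w (Some (i, 0, i))"
      using p by (intro weight_span.step weight_span.zero) auto
    then have "fa_smult a (vx v \<odot> vx v) \<in> weight_span V E1 s r w (Some (i, 0, i))"
      by (simp add: path_word_def ghost_word_def fa_mono_mult del: plus_fun_apply zero_fun_apply)
    \<comment> \<open>As a monomial the vertex occurs twice, as a path and as a ghost path;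
      idempotence identifies it with \<open>?x\<close>.\<close>
    moreover have "?x \<approx> fa_smult a (vx v \<odot> vx v)"
      using vx_vx[OF v v] by (intro eqv_smult) (auto intro: eqv_sym)
    ultimately have "?x \<in> lpa_comp V E1 s r w (Some (i, 0, i))"
      by (auto simp: lpa_comp_def eqv_def simp del: minus_apply)
    then obtain y where "y \<in> FA V E1" "?x - ?x \<odot> y \<odot> ?x \<in> lpa_ideal V E1 s r"
      using reg unfolding lpa_graded_vnr_def by blast
    then show "\<exists>b. a = a * b * a" using vnr_of_regular_scalars v by blast
  qed
  show "lpa_graded_vnr V E1 s r w TYPE('r)" if reg: "von_neumann_regular TYPE('r)"
    unfolding lpa_graded_vnr_def
  proof (intro allI ballI)
    fix g and x :: "('v,'e) gen list \<Rightarrow> 'r"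
    assume x: "x \<in> lpa_comp V E1 s r w g"
    show "\<exists>y\<in>FA V E1. x - x \<odot> y \<odot> x \<in> lpa_ideal V E1 s r"
    proof (cases g)
      case None
      \<comment> \<open>The component at zero is the zero submodule, so 0 serves as inner
        inverse.\<close>
      then have "x - x \<odot> 0 \<odot> x \<in> lpa_ideal V E1 s r"
        using x by (simp add: lpa_comp_def)
      then show ?thesis using FA_zero by blast
    next
      case (Some t)
      obtain i k j where t: "t = (i, k, j)" by (cases t)
      obtain z where z: "z \<in> weight_span V E1 s r w (Some (i, k, j))"
        "x - z \<in> lpa_ideal V E1 s r" and xFA: "x \<in> FA V E1"
        using x Some t by (auto simp: lpa_comp_def)
      obtain y where y: "y \<in> FA V E1" "z \<odot> y \<odot> z \<approx> z"
        using weight_span_regular[OF reg assms(1,4) z(1)] by blast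
      \<comment> \<open>An inner inverse of the representative \<open>z\<close> in the span is one
        of \<open>x\<close>, since the two agree modulo the ideal.\<close>
      have xz: "x \<approx> z" using xFA z(2) eqv_FA(2)[OF y(2)] by (simp add: eqv_def)
      have "x \<approx> z \<odot> y \<odot> z" using xz eqv_sym[OF y(2)] by (rule eqv_trans)
      also have "\<dots> \<approx> x \<odot> y \<odot> x"
        using y(1) eqv_sym[OF xz] by (intro eqv_mult eqv_refl)
      finally show ?thesis using y(1) by (auto simp: eqv_def)
    qed
  qed
qed

end
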